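(* Let $\Omega$, $\delta$, $\sigma_h$, $K$, $D_h(\Omega,c)$ and the two-point correlation function $\kappa^\delta(z,w;h)=\frac{D^\delta(z,w;h)}{d(w;h)d(z;h)}$ be as in the context. Then for $(z,w)\in\Omega^2\setminus D_h(\Omega,c)$ with $|z-w|\le 1/C$, $C>1$ large enough, $$\kappa^{\delta}(z,w;h)=\frac{1+\mathcal O(h)}{1-e^{-2K}}\Bigl(1+(1+\mathcal O(|z-w|))e^{-2K}+\frac{1+\mathcal O(|z-w|)}{e^K\sinh(K)}\bigl(2K^2\coth(K)-4K\bigr)+\mathcal O\bigl(h^\infty+\delta h^{-32/10}\bigr)\Bigr)+\mathcal O\bigl(e^{-D/h^2}\bigr),$$ where $D>0$ is a constant. Moreover: (i) for $h^{4/7}\ll|z-w|\ll h^{1/2}$, $$\kappa^\delta(z,w;h)=\frac{\sigma_h(z,w)|z-w|^2}{4h}\Bigl(1+\mathcal O\Bigl(\frac{|z-w|^2}{h}+\delta h^{-8/5}\Bigr)\Bigr)\ll1;$$ (ii) for $|z-w|\gg(h\ln h^{-1})^{1/2}$, $$\kappa^\delta(z,w;h)=1+\mathcal O(h).$$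
   Context: Operator. Let $0<h\ll1$, $S^1=\mathbb R/2\pi\mathbb Z$, $D_x=\frac1i\frac{d}{dx}$ and $P_h=hD_x+g(x)$ on $L^2(S^1)$, where $g\in C^\infty(S^1;\mathbb C)$ is such that $\mathrm{Im}\,g$ has exactly two critical points, both non-degenerate: a minimum at $a$ and a maximum at $b$. Let $p(x,\xi)=\xi+g(x)$ on $T^*S^1$, $\{p,\overline p\}=p'_\xi\,\overline p'_x-p'_x\,\overline p'_\xi$, and $\Sigma=\overline{p(T^*S^1)}$. For $z\in\mathring\Sigma$ the equation $p=z$ has exactly two solutions $\rho_\pm(z)=(x_\pm(z),\xi_\pm(z))$, where $\mathrm{Im}\,g(x_\pm)=\mathrm{Im}\,z$, $\pm\mathrm{Im}\,g'(x_\pm)<0$, $\xi_\pm=\mathrm{Re}\,z-\mathrm{Re}\,g(x_\pm)$. Points of $S^1$ are lifted to $\mathbb R$ so that $b-2\pi<x_+<a<x_-<b$. Set $$\sigma(z)=\frac{2i}{\{p,\overline p\}(\rho_+(z))}+\frac{2i}{\{\overline p,p\}(\rho_-(z))}.$$ Domain. $\Omega\Subset\mathring\Sigma$ is open, convex, relatively compact, simply connected, with $\mathrm{dist}(\Omega,\partial\Sigma)>1/C$ for some $C>1$ independent of $h$. Perturbation. $P_h^\delta=P_h+\delta Q_\omega$, $Q_\omega u=\sum_{|j|,|k|\le\lfloor C_1/h\rfloor}\alpha_{j,k}(u|e^k)e^j$, with $C_1>0$ a large enough constant, $e^k(x)=(2\pi)^{-1/2}e^{ikx}$, and $\alpha_{j,k}$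 independent standard complex Gaussian $\mathcal N_{\mathbb C}(0,1)$. Let $N=(2\lfloor C_1/h\rfloor+1)^2$ and let $B(0,R)\subset\mathbb C^N$ be the open ball of radius $R=C'/h$, $C'>0$ large enough. Coupling constant. Let $S(z)=\min\bigl(\mathrm{Im}\int_{x_+}^{x_-}(z-g(y))dy,\ \mathrm{Im}\int_{x_+}^{x_--2\pi}(z-g(y))dy\bigr)$. We assume $\delta=\sqrt h\,e^{-\epsilon_0(h)/h}$ with $(\kappa-\frac12)h\ln(h^{-1})+C_0h\le\epsilon_0(h)<\min_{z\in\overline\Omega}S(z)/C_0$ for some $\kappa>52/10$ and some large $C_0>0$, uniformly in $h$. One-point density. $d(z;h)$ is the density in $\mathbb E[\sum_{z\in\sigma(P_h^\delta)}\varphi(z)\mathbf 1_{B(0,R)}(\alpha)]=\int\varphi(z)d(z;h)L(dz)$, $\varphi\in C_0(\Omega)$ (eigenvalues counted with multiplicity); it is known that $d(z;h)=\frac1{2\pi h}\sigma(z)+\mathcal O(1)$. Two-point density. The measure $\nu$ is defined by $\mathbb E[\sum_{z,w\in\sigma(P_h^\delta),z\ne w}\varphi(z,w)\mathbf 1_{B(0,R)}(\alpha)]=\int\varphi\,d\nu$, $\varphi\in C_0(\Omega^2)$. With $D_h(\Omega,c)=\{(z,w)\in\Omega^2:|z-w|\le c\,h^{3/5}\}$, there are constants $c,D>0$ such that on $\{(z,w)\in\Omega^2\setminus D_h(\Omega,c):|z-w|\le1/C\}$ the measure $\nu$ has a smooth Lebesgue density $D^\delta(z,w;h)$, and there are smooth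 functions $\sigma_h(z,w)=\sigma(\frac{z+w}2)+\mathcal O(h)$ and $K=K(z,w;h)=\sigma_h(z,w)\frac{|z-w|^2}{4h}(1+\mathcal O(|z-w|+h^\infty))$ such that $$D^{\delta}=\frac{\Lambda}{(2\pi h)^2(1-e^{-2K})}\bigl(1+\mathcal O(\delta h^{-8/5})\bigr)+\mathcal O(e^{-D/h^2}),$$ $$\Lambda=\sigma_h(z,z)\sigma_h(w,w)+\sigma_h(z,w)^2(1+\mathcal O(|z-w|))e^{-2K}+\frac{\sigma_h(z,w)^2(1+\mathcal O(|z-w|))}{e^K\sinh K}(2K^2\coth K-4K)+\mathcal O(h^\infty+\delta h^{-32/10}).$$ These are the $D^\delta$, $\sigma_h$, $K$, $c$ of the claim. Conventions: $A\gg B$ means $A\ge MB$ with a sufficiently large constant $M$ (similarly $\ll$); all $\mathcal O$ are uniform in $(z,w)$ as $h\to0^+$. *)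

theory Defs
  imports
    "HOL-Probability.Probability"
    "HOL-Library.Landau_Symbols"
    "HOL-Library.Function_Algebras"
begin

section \<open>Smooth functions, test functions, semiclassical asymptotics\<close>

fun cont_diff_on :: "nat \<Rightarrow> 'a::euclidean_space set \<Rightarrow> ('a \<Rightarrow> 'b::real_normed_vector) \<Rightarrow> bool" where
  "cont_diff_on 0 V f \<longleftrightarrow> continuous_on V f"
| "cont_diff_on (Suc k) V f \<longleftrightarrow> f differentiable_on V \<and>
     (\<forall>e\<in>Basis. cont_diff_on k V (\<lambda>x. frechet_derivative f (at x) e))"

text \<open>\<^const>\<open>cont_diff_on\<close> is only meaningful on open sets; on an arbitrary set, smooth means
  being the restriction of a smooth function on an open neighbourhood.\<close>

definition smooth_on :: "'a::euclidean_space set \<Rightarrow> ('a \<Rightarrow> 'b::real_normed_vector) \<Rightarrow> bool" where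
  "smooth_on A f \<longleftrightarrow> (\<exists>V F. open V \<and> A \<subseteq> V \<and> (\<forall>k. cont_diff_on k V F) \<and> (\<forall>x\<in>A. F x = f x))"

definition test_functions :: "'a::topological_space set \<Rightarrow> ('a \<Rightarrow> complex) set" where
  "test_functions U = {\<phi>. continuous_on UNIV \<phi> \<and>
     compact (closure {x. \<phi> x \<noteq> 0}) \<and> closure {x. \<phi> x \<noteq> 0} \<subseteq> U}"

text \<open>The filter of the limit \<open>h \<rightarrow> 0\<^sup>+\<close>, uniformly in the points of the
  \<open>h\<close>-dependent region \<open>R h\<close>; see \<open>bigo_semiclassical_iff\<close> below.\<close>

definition semiclassical :: "(real \<Rightarrow> 'a set) \<Rightarrow> (real \<times> 'a) filter" where
  "semiclassical R = inf (filtercomap fst (at_right 0)) (principal {(h, p). p \<in> R h})"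

lemma eventually_semiclassical_iff:
  "eventually P (semiclassical R) \<longleftrightarrow> (\<exists>h0>0. \<forall>h p. 0 < h \<and> h < h0 \<and> p \<in> R h \<longrightarrow> P (h, p))"
  unfolding semiclassical_def eventually_inf_principal eventually_filtercomap
    eventually_at_right_field
proof safe
  fix Q and b :: real
  assume "0 < b" "\<forall>y>0. y < b \<longrightarrow> Q y"
    and "\<forall>x. Q (fst x) \<longrightarrow> x \<in> {(h, p). p \<in> R h} \<longrightarrow> P x"
  then show "\<exists>h0>0. \<forall>h p. 0 < h \<and> h < h0 \<and> p \<in> R h \<longrightarrow> P (h, p)"
    by (intro exI[of _ b]) auto
next
  fix h0 :: real
  assume "0 < h0" "\<forall>h p. 0 < h \<and> h < h0 \<and> p \<in> R h \<longrightarrow> P (h, p)"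
  then show "\<exists>Q. (\<exists>b>0. \<forall>y>0. y < b \<longrightarrow> Q y) \<and>
      (\<forall>x. Q (fst x) \<longrightarrow> x \<in> {(h, p). p \<in> R h} \<longrightarrow> P x)"
    by (intro exI[of _ "\<lambda>h. 0 < h \<and> h < h0"]) auto
qed

lemma bigo_semiclassical_iff:
  "f \<in> O[semiclassical R](g) \<longleftrightarrow>
    (\<exists>A>0. \<exists>h0>0. \<forall>h p. 0 < h \<and> h < h0 \<and> p \<in> R h \<longrightarrow> norm (f (h, p)) \<le> A * norm (g (h, p)))"
  by (simp add: bigo_def eventually_semiclassical_iff)

definition bigo_h_infinity :: "(real \<times> 'a) filter \<Rightarrow> (real \<times> 'a \<Rightarrow> real) set" where
  "bigo_h_infinity F = (\<Inter>n::nat. O[F](\<lambda>x. fst x ^ n))"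


section \<open>The symbol\<close>

text \<open>Functions on \<open>S\<^sup>1 = \<real> / 2\<pi>\<int>\<close> are \<open>2\<pi>\<close>-periodic functions on \<open>\<real>\<close>.\<close>

definition periodic :: "(real \<Rightarrow> complex) \<Rightarrow> bool" where
  "periodic f \<longleftrightarrow> (\<forall>x. f (x + 2 * pi) = f x)"

text \<open>Points of the circle are lifted so that \<open>b - 2\<pi> < a < b\<close>.\<close>

definition admissible_potential :: "(real \<Rightarrow> complex) \<Rightarrow> real \<Rightarrow> real \<Rightarrow> bool" where
  "admissible_potential g a b \<longleftrightarrow>
     periodic g \<and> smooth_on UNIV g \<and> b - 2 * pi < a \<and> a < b \<and>
     {x. deriv (\<lambda>t. Im (g t)) x = 0} = {x. \<exists>k::int. x = a + 2 * pi * k \<or> x = b + 2 * pi * k} \<and>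
     deriv (deriv (\<lambda>t. Im (g t))) a \<noteq> 0 \<and> deriv (deriv (\<lambda>t. Im (g t))) b \<noteq> 0 \<and>
     (\<forall>x. Im (g a) \<le> Im (g x) \<and> Im (g x) \<le> Im (g b))"

definition symb :: "(real \<Rightarrow> complex) \<Rightarrow> real \<times> real \<Rightarrow> complex" where
  "symb g = (\<lambda>(x, \<xi>). complex_of_real \<xi> + g x)"

definition Sigma_set :: "(real \<Rightarrow> complex) \<Rightarrow> complex set" where
  "Sigma_set g = closure (range (symb g))"

definition poisson_bracket ::
    "(real \<times> real \<Rightarrow> complex) \<Rightarrow> (real \<times> real \<Rightarrow> complex) \<Rightarrow> real \<times> real \<Rightarrow> complex" where
  "poisson_bracket p q = (\<lambda>(x, \<xi>).
     vector_derivative (\<lambda>\<eta>. p (x, \<eta>)) (at \<xi>) * vector_derivative (\<lambda>y. q (y, \<xi>)) (at x)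
   - vector_derivative (\<lambda>y. p (y, \<xi>)) (at x) * vector_derivative (\<lambda>\<eta>. q (x, \<eta>)) (at \<xi>))"

definition x_plus :: "(real \<Rightarrow> complex) \<Rightarrow> real \<Rightarrow> real \<Rightarrow> complex \<Rightarrow> real" where
  "x_plus g a b z = (THE x. b - 2 * pi < x \<and> x < a \<and>
     Im (g x) = Im z \<and> deriv (\<lambda>t. Im (g t)) x < 0)"

definition x_minus :: "(real \<Rightarrow> complex) \<Rightarrow> real \<Rightarrow> real \<Rightarrow> complex \<Rightarrow> real" where
  "x_minus g a b z = (THE x. a < x \<and> x < b \<and>
     Im (g x) = Im z \<and> deriv (\<lambda>t. Im (g t)) x > 0)"

definition rho_plus :: "(real \<Rightarrow> complex) \<Rightarrow> real \<Rightarrow> real \<Rightarrow> complex \<Rightarrow> real \<times> real" where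
  "rho_plus g a b z = (x_plus g a b z, Re z - Re (g (x_plus g a b z)))"

definition rho_minus :: "(real \<Rightarrow> complex) \<Rightarrow> real \<Rightarrow> real \<Rightarrow> complex \<Rightarrow> real \<times> real" where
  "rho_minus g a b z = (x_minus g a b z, Re z - Re (g (x_minus g a b z)))"

text \<open>The values of \<open>sigma_weight\<close> are real, but the defining formula is complex.\<close>

definition sigma_weight :: "(real \<Rightarrow> complex) \<Rightarrow> real \<Rightarrow> real \<Rightarrow> complex \<Rightarrow> complex" where
  "sigma_weight g a b z =
     2 * \<i> / poisson_bracket (symb g) (cnj \<circ> symb g) (rho_plus g a b z)
   + 2 * \<i> / poisson_bracket (cnj \<circ> symb g) (symb g) (rho_minus g a b z)"

text \<open>In the second integral the upper limit is smaller than the lower one; the interval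
  integral is oriented.\<close>

definition action :: "(real \<Rightarrow> complex) \<Rightarrow> real \<Rightarrow> real \<Rightarrow> complex \<Rightarrow> real" where
  "action g a b z = min
     (Im (LBINT y = ereal (x_plus g a b z)..ereal (x_minus g a b z). z - g y))
     (Im (LBINT y = ereal (x_plus g a b z)..ereal (x_minus g a b z - 2 * pi). z - g y))"

definition admissible_domain :: "(real \<Rightarrow> complex) \<Rightarrow> complex set \<Rightarrow> bool" where
  "admissible_domain g \<Omega> \<longleftrightarrow>
     open \<Omega> \<and> convex \<Omega> \<and> simply_connected \<Omega> \<and>
     compact (closure \<Omega>) \<and> closure \<Omega> \<subseteq> interior (Sigma_set g) \<and>
     (\<exists>C>1. setdist \<Omega> (frontier (Sigma_set g)) > 1 / C)"


section \<open>The operator and its spectrum\<close>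

definition L2_circle :: "(real \<Rightarrow> complex) set" where
  "L2_circle = {f. f \<in> borel_measurable borel \<and> periodic f \<and>
     set_integrable lborel {0..2*pi} (\<lambda>x. (cmod (f x))\<^sup>2)}"

definition L2_norm_circle :: "(real \<Rightarrow> complex) \<Rightarrow> real" where
  "L2_norm_circle f = sqrt (LINT x:{0..2*pi}|lborel. (cmod (f x))\<^sup>2)"

definition L2_inner_circle :: "(real \<Rightarrow> complex) \<Rightarrow> (real \<Rightarrow> complex) \<Rightarrow> complex" where
  "L2_inner_circle u v = (LINT x:{0..2*pi}|lborel. u x * cnj (v x))"

text \<open>\<open>u\<close> is the continuous representative of an element of the Sobolev space \<open>H\<^sup>1(S\<^sup>1)\<close>,
  with weak derivative \<open>v\<close>.\<close>

definition H1_derivative :: "(real \<Rightarrow> complex) \<Rightarrow> (real \<Rightarrow> complex) \<Rightarrow> bool" where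
  "H1_derivative u v \<longleftrightarrow> periodic u \<and> v \<in> L2_circle \<and>
     (\<forall>s t. s \<le> t \<longrightarrow> u t - u s = (LINT x:{s..t}|lborel. v x))"

definition fourier_mode :: "int \<Rightarrow> real \<Rightarrow> complex" where
  "fourier_mode k x = exp (\<i> * of_int k * of_real x) / of_real (sqrt (2 * pi))"

definition mode_pairs :: "real \<Rightarrow> real \<Rightarrow> (int \<times> int) set" where
  "mode_pairs C1 h = {- \<lfloor>C1 / h\<rfloor>..\<lfloor>C1 / h\<rfloor>} \<times> {- \<lfloor>C1 / h\<rfloor>..\<lfloor>C1 / h\<rfloor>}"

definition perturbation ::
    "real \<Rightarrow> real \<Rightarrow> (int \<times> int \<Rightarrow> complex) \<Rightarrow> (real \<Rightarrow> complex) \<Rightarrow> real \<Rightarrow> complex" where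
  "perturbation C1 h \<alpha> u x =
     (\<Sum>(j, k)\<in>mode_pairs C1 h. \<alpha> (j, k) * L2_inner_circle u (fourier_mode k) * fourier_mode j x)"

text \<open>The graph of the unbounded operator \<open>h D\<^sub>x + g + \<delta> Q\<close> on \<open>L\<^sup>2(S\<^sup>1)\<close> with domain
  \<open>H\<^sup>1(S\<^sup>1)\<close>. The first component is the continuous representative of an element of the domain,
  the second one an arbitrary representative of its image.\<close>

definition operator_graph ::
    "(real \<Rightarrow> complex) \<Rightarrow> real \<Rightarrow> real \<Rightarrow> real \<Rightarrow> (int \<times> int \<Rightarrow> complex) \<Rightarrow>
     ((real \<Rightarrow> complex) \<times> (real \<Rightarrow> complex)) set" where
  "operator_graph g C1 h \<delta> \<alpha> = {(u, f). f \<in> L2_circle \<and>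
     (\<exists>v. H1_derivative u v \<and>
       (AE x in lborel. f x = of_real h * (v x / \<i>) + g x * u x
                              + of_real \<delta> * perturbation C1 h \<alpha> u x))}"

definition op_spectrum :: "((real \<Rightarrow> complex) \<times> (real \<Rightarrow> complex)) set \<Rightarrow> complex set" where
  "op_spectrum T = - {z.
     (\<forall>f\<in>L2_circle. \<exists>!u. (u, \<lambda>x. z * u x + f x) \<in> T) \<and>
     (\<exists>B. \<forall>(u, f)\<in>T. L2_norm_circle u \<le> B * L2_norm_circle (\<lambda>x. f x - z * u x))}"

primrec gen_kernel ::
    "((real \<Rightarrow> complex) \<times> (real \<Rightarrow> complex)) set \<Rightarrow> complex \<Rightarrow> nat \<Rightarrow> (real \<Rightarrow> complex) set" where
  "gen_kernel T z 0 = {0}"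
| "gen_kernel T z (Suc n) = {u. \<exists>w\<in>gen_kernel T z n. (u, \<lambda>x. z * u x + w x) \<in> T}"

interpretation fun_space: vector_space "\<lambda>(c::complex) (u::real \<Rightarrow> complex) x. c * u x"
  by unfold_locales (auto simp: fun_eq_iff algebra_simps)

text \<open>Algebraic multiplicity: the dimension of the generalized eigenspace. All elements of
  \<^const>\<open>gen_kernel\<close> are continuous, so that this is indeed a dimension in \<open>L\<^sup>2(S\<^sup>1)\<close>.\<close>

definition alg_mult :: "((real \<Rightarrow> complex) \<times> (real \<Rightarrow> complex)) set \<Rightarrow> complex \<Rightarrow> nat" where
  "alg_mult T z = fun_space.dim (\<Union>n. gen_kernel T z n)"


section \<open>Random perturbation and correlation densities\<close>

definition complex_gaussian :: "complex measure" where
  "complex_gaussian = density lborel (\<lambda>z. ennreal (exp (- (cmod z)\<^sup>2) / pi))"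

text \<open>\<open>\<E>[X(\<alpha>) 1\<^bsub>B(0, C'/h)\<^esub>(\<alpha>)]\<close> for independent standard complex Gaussian coefficients.\<close>

definition trunc_expectation ::
    "real \<Rightarrow> real \<Rightarrow> real \<Rightarrow> ((int \<times> int \<Rightarrow> complex) \<Rightarrow> complex) \<Rightarrow> complex" where
  "trunc_expectation C1 C' h X =
     (LINT \<alpha>|PiM (mode_pairs C1 h) (\<lambda>_. complex_gaussian).
        of_bool (sqrt (\<Sum>i\<in>mode_pairs C1 h. (cmod (\<alpha> i))\<^sup>2) < C' / h) * X \<alpha>)"

definition one_point_density ::
    "(real \<Rightarrow> complex) \<Rightarrow> real \<Rightarrow> real \<Rightarrow> real \<Rightarrow> real \<Rightarrow> complex set \<Rightarrow> (complex \<Rightarrow> real) \<Rightarrow> bool" where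
  "one_point_density g C1 C' h \<delta> \<Omega> d \<longleftrightarrow>
     (\<forall>\<phi>\<in>test_functions \<Omega>.
        integrable lborel (\<lambda>z. \<phi> z * of_real (d z)) \<and>
        trunc_expectation C1 C' h
          (\<lambda>\<alpha>. let T = operator_graph g C1 h \<delta> \<alpha>
               in \<Sum>\<^sub>\<infinity>z\<in>op_spectrum T. of_nat (alg_mult T z) * \<phi> z)
        = (LINT z|lborel. \<phi> z * of_real (d z)))"

definition two_point_measure ::
    "(real \<Rightarrow> complex) \<Rightarrow> real \<Rightarrow> real \<Rightarrow> real \<Rightarrow> real \<Rightarrow> complex set \<Rightarrow>
     (complex \<times> complex) measure \<Rightarrow> bool" where
  "two_point_measure g C1 C' h \<delta> \<Omega> \<nu> \<longleftrightarrow>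
     sets \<nu> = sets (restrict_space borel (\<Omega> \<times> \<Omega>)) \<and>
     (\<forall>A. compact A \<and> A \<subseteq> \<Omega> \<times> \<Omega> \<longrightarrow> emeasure \<nu> A < \<infinity>) \<and>
     (\<forall>\<phi>\<in>test_functions (\<Omega> \<times> \<Omega>).
        trunc_expectation C1 C' h
          (\<lambda>\<alpha>. let T = operator_graph g C1 h \<delta> \<alpha>
               in \<Sum>\<^sub>\<infinity>(z, w)\<in>{(z, w). z \<in> op_spectrum T \<and> w \<in> op_spectrum T \<and> z \<noteq> w}.
                    of_nat (alg_mult T z * alg_mult T w) * \<phi> (z, w))
        = (LINT p|\<nu>. \<phi> p))"

definition lebesgue_density_on ::
    "(complex \<times> complex) set \<Rightarrow> (complex \<times> complex) measure \<Rightarrow>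
     (complex \<times> complex \<Rightarrow> real) \<Rightarrow> bool" where
  "lebesgue_density_on S \<nu> f \<longleftrightarrow> (\<forall>p\<in>S. 0 \<le> f p) \<and>
     (\<forall>A\<in>sets borel. A \<subseteq> S \<longrightarrow> emeasure \<nu> A = (\<integral>\<^sup>+ p\<in>A. ennreal (f p) \<partial>lborel))"

definition near_diagonal :: "complex set \<Rightarrow> real \<Rightarrow> (complex \<times> complex) set" where
  "near_diagonal \<Omega> C = {(z, w). z \<in> \<Omega> \<and> w \<in> \<Omega> \<and> cmod (z - w) \<le> 1 / C}"

definition D_set :: "complex set \<Rightarrow> real \<Rightarrow> real \<Rightarrow> (complex \<times> complex) set" where
  "D_set \<Omega> c h = {(z, w). z \<in> \<Omega> \<and> w \<in> \<Omega> \<and> cmod (z - w) \<le> c * h powr (3/5)}"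

definition two_point_correlation ::
    "(real \<Rightarrow> complex \<Rightarrow> real) \<Rightarrow> (real \<Rightarrow> complex \<Rightarrow> complex \<Rightarrow> real) \<Rightarrow>
     real \<Rightarrow> complex \<Rightarrow> complex \<Rightarrow> real" where
  "two_point_correlation d D h z w = D h z w / (d h w * d h z)"

definition coth :: "real \<Rightarrow> real" where
  "coth x = cosh x / sinh x"

end

theory Submission
  imports Defs "HOL-Real_Asymp.Real_Asymp"
begin

text \<open>With \<open>q = Im g\<close>, the weight is \<open>\<sigma>(z) = 1 / |q'(x\<^sub>+)| + 1 / |q'(x\<^sub>-)|\<close>, and \<open>x\<^sub>\<plusminus>(z)\<close> are values
  of the inverses of the two monotone branches of \<open>q\<close> at \<open>Im z\<close>. On \<open>\<Omega>\<close> it is therefore bounded,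
  bounded away from zero and Lipschitz, so that dividing \<open>D\<^sup>\<delta>\<close> by the one-point densities only
  changes the factors \<open>1 + \<O>(h)\<close> and \<open>1 + \<O>(|z - w|)\<close>. Off \<open>D\<^sub>h(\<Omega>,c)\<close> one has \<open>h = \<O>(|z - w|)\<close>,
  and \<open>\<delta> \<le> h\<^bsup>26/5\<^esup>\<close> makes the \<open>\<delta>\<close>-dependent errors \<open>\<O>(h)\<close>.
  Without the error terms, the correlation is
  \<open>coth K + (K\<^sup>2 coth K - 2 K) / sinh\<^sup>2 K = K + \<O>(K\<^sup>3)\<close> for small \<open>K\<close>, and it is
  \<open>1 + \<O>(e\<^bsup>-K\<^esup>)\<close> for large \<open>K\<close>. As \<open>K\<close> is comparable to \<open>|z - w|\<^sup>2 / h\<close>, this gives (i) and (ii).\<close>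

section \<open>The weight on the domain\<close>

text \<open>The obstacle sits at small \<open>K\<close>. After division by
  \<open>1 - exp (- 2 * K)\<close> each of the three summands of the correlation has size 1/K, and
  only their sum cancels down to K: the bracket starts as 1 + 1 - 2. The factors 1 + O(|z - w|)
  break this cancellation and leave errors of size |z - w| / K. With x = |z - w|^2 / h, which is
  comparable to K, a relative error O(x) requires |z - w| / x = O(x^2), that is h^3 = O(|z - w|^5).
  This is how lower bounds for |z - w| by powers of h enter: h^(3/5) is the critical one, and
  h^(4/7) lies above it. For large K nothing cancels, because the exponential terms are themselves
  O(h) as soon as K \<ge> ln (1/h), up to polynomial factors in K. The large constants of the claim
  answer demands on K: \<open>C2\<close> keeps K within a factor 2 of its leading term,
  \<open>M0\<close> brings it below the radius where the expansion at 0 holds, and \<open>M2\<close>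
  lifts it above ln (1/h).\<close>

lemma smooth_on_UNIV_derivatives:
  fixes g :: "real \<Rightarrow> complex"
  assumes "smooth_on UNIV g"
  obtains g1 g2 where "\<And>x. (g has_vector_derivative g1 x) (at x)"
    "\<And>x. (g1 has_vector_derivative g2 x) (at x)" "continuous_on UNIV g2"
proof -
  have works: "(f has_vector_derivative frechet_derivative f (at x) 1) (at x)"
    if "f differentiable_on UNIV" for f :: "real \<Rightarrow> complex" and x
  proof -
    have "(f has_derivative frechet_derivative f (at x)) (at x)"
      using that frechet_derivative_works by (auto simp: differentiable_on_def)
    moreover from this have "frechet_derivative f (at x) = (\<lambda>y. y *\<^sub>R frechet_derivative f (at x) 1)"
      by (metis has_derivative_linear linear_scale mult.right_neutral real_scaleR_def)
    ultimately show ?thesis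
      by (simp add: has_vector_derivative_def)
  qed
  from assms have "cont_diff_on (Suc (Suc 0)) UNIV g"
    unfolding smooth_on_def by (metis UNIV_I ext top.extremum_uniqueI)
  then show thesis
    by (intro that[OF works works]) auto
qed

text \<open>The end points \<open>A\<close> and \<open>B\<close> will be critical points, where the
  inverse of \<open>q\<close> is singular. The strict inequalities \<open>q A < m\<close> and
  \<open>n < q B\<close> confine the preimage of \<open>{m..n}\<close> to a compact part of
  \<open>{A<..<B}\<close>, on which \<open>q1\<close> has a positive minimum. The variation of
  \<open>q1\<close> is measured by \<open>q x\<close> because later \<open>q x\<close> is
  \<open>Im z\<close>.\<close>

lemma branch_regularity:
  fixes q q1 q2 :: "real \<Rightarrow> real"
  assumes q: "\<And>x. (q has_real_derivative q1 x) (at x)"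
    and q1: "\<And>x. (q1 has_real_derivative q2 x) (at x)"
    and q2: "continuous_on UNIV q2"
    and pos: "\<And>x. A < x \<Longrightarrow> x < B \<Longrightarrow> 0 < q1 x"
    and "A < B" "q A < m" "m \<le> n" "n < q B"
  shows "\<exists>l>0. \<exists>L.
    (\<forall>y\<in>{m..n}. \<exists>!x. A < x \<and> x < B \<and> q x = y) \<and>
    (\<forall>x\<in>{A<..<B}. q x \<in> {m..n} \<longrightarrow> l \<le> q1 x \<and> q1 x \<le> L) \<and>
    (\<forall>x\<in>{A<..<B}. \<forall>x'\<in>{A<..<B}. q x \<in> {m..n} \<longrightarrow> q x' \<in> {m..n} \<longrightarrow>
       \<bar>q1 x - q1 x'\<bar> \<le> L * \<bar>q x - q x'\<bar>)"
proof -
  have cont: "continuous_on T q" "continuous_on T q1" for T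
    using q q1 by (meson DERIV_continuous_on has_field_derivative_at_within)+
  have mono: "q x < q y" if "A \<le> x" "x < y" "y \<le> B" for x y
    using that pos by (intro DERIV_pos_imp_increasing_open[OF \<open>x < y\<close> _ cont(1)])
      (meson q le_less_trans less_le_trans)
  have ex1: "\<exists>!x. A < x \<and> x < B \<and> q x = y" if y: "y \<in> {m..n}" for y
  proof -
    obtain x where x: "A \<le> x" "x \<le> B" "q x = y"
      using IVT'[of q A y B] y assms(5-) cont by auto
    have "x \<noteq> A" "x \<noteq> B"
      using x y assms(5-) by auto
    then have "A < x \<and> x < B \<and> q x = y"
      using x by auto
    moreover have "x' = x" if "A < x' \<and> x' < B \<and> q x' = y" for x'
      using that x mono[of x x'] mono[of x' x] by (cases x x' rule: linorder_cases) auto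
    ultimately show ?thesis
      by blast
  qed
  obtain \<alpha> where \<alpha>: "A < \<alpha>" "\<alpha> < B" "q \<alpha> = m"
    using ex1[of m] assms by auto
  obtain \<beta> where \<beta>: "A < \<beta>" "\<beta> < B" "q \<beta> = n"
    using ex1[of n] assms by auto
  have "\<alpha> \<le> \<beta>"
    using mono[of \<beta> \<alpha>] \<alpha> \<beta> \<open>m \<le> n\<close> by fastforce
  have bd: "x \<in> {\<alpha>..\<beta>}" if "A < x" "x < B" "q x \<in> {m..n}" for x
    using mono[of x \<alpha>] mono[of \<beta> x] that \<alpha> \<beta> by fastforce
  obtain x0 where x0: "x0 \<in> {\<alpha>..\<beta>}" "\<And>x. x \<in> {\<alpha>..\<beta>} \<Longrightarrow> q1 x0 \<le> q1 x"
    using continuous_attains_inf[OF compact_Icc _ cont(2), of \<alpha> \<beta>] \<open>\<alpha> \<le> \<beta>\<close> by auto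
  obtain x1 where x1: "x1 \<in> {\<alpha>..\<beta>}" "\<And>x. x \<in> {\<alpha>..\<beta>} \<Longrightarrow> q1 x \<le> q1 x1"
    using continuous_attains_sup[OF compact_Icc _ cont(2), of \<alpha> \<beta>] \<open>\<alpha> \<le> \<beta>\<close> by auto
  have "continuous_on {\<alpha>..\<beta>} (\<lambda>x. \<bar>q2 x\<bar>)"
    using q2 by (intro continuous_intros) (auto intro: continuous_on_subset)
  then obtain x2 where x2: "x2 \<in> {\<alpha>..\<beta>}" "\<And>x. x \<in> {\<alpha>..\<beta>} \<Longrightarrow> \<bar>q2 x\<bar> \<le> \<bar>q2 x2\<bar>"
    using continuous_attains_sup[OF compact_Icc, of \<alpha> \<beta> "\<lambda>x. \<bar>q2 x\<bar>"] \<open>\<alpha> \<le> \<beta>\<close> by auto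
  define l where "l = q1 x0"
  define M where "M = \<bar>q2 x2\<bar>"
  have "0 < l"
    unfolding l_def using pos x0 \<alpha> \<beta> by auto
  \<comment> \<open>Mean values of \<open>q\<close> and of \<open>q1\<close> over the same interval:
    the ratio of the two increments is at most \<open>M / l\<close>, and the inverse of
    \<open>q\<close> never has to be differentiated.\<close>
  have lip: "\<bar>q1 x - q1 x'\<bar> \<le> M / l * \<bar>q x - q x'\<bar>" if xx: "x \<in> {\<alpha>..\<beta>}" "x' \<in> {\<alpha>..\<beta>}" "x < x'" for x x'
  proof -
    obtain u where u: "x < u" "u < x'" "q x' - q x = (x' - x) * q1 u"
      using MVT2[OF \<open>x < x'\<close>, of q q1] q by auto
    obtain v where v: "x < v" "v < x'" "q1 x' - q1 x = (x' - x) * q2 v"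
      using MVT2[OF \<open>x < x'\<close>, of q1 q2] q1 by auto
    have "l * (x' - x) \<le> q x' - q x"
      using u x0(2)[of u] xx by (auto simp: l_def mult.commute)
    moreover have "\<bar>q1 x' - q1 x\<bar> \<le> M * (x' - x)"
      using v x2(2)[of v] xx by (auto simp: M_def abs_mult mult.commute)
    moreover have "M \<ge> 0"
      by (simp add: M_def)
    ultimately have "l * \<bar>q1 x' - q1 x\<bar> \<le> M * \<bar>q x' - q x\<bar>"
      using \<open>0 < l\<close> by (smt (verit) mult.left_commute mult_left_mono)
    then show ?thesis
      using \<open>0 < l\<close> by (simp add: field_simps abs_minus_commute)
  qed
  have lip': "\<bar>q1 x - q1 x'\<bar> \<le> M / l * \<bar>q x - q x'\<bar>" if "x \<in> {\<alpha>..\<beta>}" "x' \<in> {\<alpha>..\<beta>}" for x x'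
    using lip[of x x'] lip[of x' x] that by (cases x x' rule: linorder_cases) (auto simp: abs_minus_commute)
  show ?thesis
  \<comment> \<open>One constant serves both as upper bound of \<open>q1\<close> and as Lipschitz
    constant, hence the maximum.\<close>
  proof (rule exI[of _ l], rule conjI[OF \<open>0 < l\<close>], rule exI[of _ "max (q1 x1) (M / l)"],
      intro conjI ballI impI ex1)
    fix x assume x: "x \<in> {A<..<B}" "q x \<in> {m..n}"
    then show "l \<le> q1 x" "q1 x \<le> max (q1 x1) (M / l)"
      using bd[of x] x0(2)[of x] x1(2)[of x] by (auto simp: l_def)
  next
    fix x x' assume x: "x \<in> {A<..<B}" "q x \<in> {m..n}" and x': "x' \<in> {A<..<B}" "q x' \<in> {m..n}"
    show "\<bar>q1 x - q1 x'\<bar> \<le> max (q1 x1) (M / l) * \<bar>q x - q x'\<bar>"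
      using lip'[OF bd[of x] bd[of x']] x x'
      by (meson abs_ge_zero greaterThanLessThan_iff max.cobounded2 mult_right_mono order_trans)
  qed
qed

text \<open>The symbol has \<xi>-derivative 1, so the first bracket is \<open>cnj g' - g'\<close>.
  Hence the two summands of \<open>sigma_weight\<close> are \<open>- 1 / Im g'\<close> at
  \<open>x_plus\<close> and \<open>1 / Im g'\<close> at \<open>x_minus\<close>, both
  positive.\<close>

lemma poisson_bracket_symb:
  assumes "(g has_vector_derivative g') (at x)"
  shows "poisson_bracket (symb g) (cnj \<circ> symb g) (x, \<xi>) = - 2 * \<i> * of_real (Im g')"
    and "poisson_bracket (cnj \<circ> symb g) (symb g) (x, \<xi>) = 2 * \<i> * of_real (Im g')"
proof -
  have [derivative_intros]: "((\<lambda>y. g y) has_vector_derivative g') (at x)"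
    using assms by simp
  have 1: "((\<lambda>y. of_real \<xi> + g y) has_vector_derivative g') (at x)"
    by (auto intro!: derivative_eq_intros)
  have 2: "((\<lambda>\<eta>. of_real \<eta> + g x) has_vector_derivative 1) (at \<xi>)"
    by (auto intro!: derivative_eq_intros)
  have 3: "((\<lambda>y. cnj (of_real \<xi> + g y)) has_vector_derivative cnj g') (at x)"
    using 1 by (rule has_vector_derivative_cnj)
  have 4: "((\<lambda>\<eta>. cnj (of_real \<eta> + g x)) has_vector_derivative cnj 1) (at \<xi>)"
    using 2 by (rule has_vector_derivative_cnj)
  note v = 1 2 3 4
  show "poisson_bracket (symb g) (cnj \<circ> symb g) (x, \<xi>) = - 2 * \<i> * of_real (Im g')"
    "poisson_bracket (cnj \<circ> symb g) (symb g) (x, \<xi>) = 2 * \<i> * of_real (Im g')"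
    using v[THEN vector_derivative_at]
    by (simp_all add: poisson_bracket_def symb_def comp_def complex_eq_iff)
qed

text \<open>\<open>Sigma_set g\<close> lies in the closed strip between the extreme values of
  \<open>Im g\<close>. An interior point can be shifted up and down without leaving the strip, so
  both inequalities are strict.\<close>

lemma interior_Sigma_set:
  assumes "admissible_potential g a b" "z \<in> interior (Sigma_set g)"
  shows "Im (g a) < Im z" "Im z < Im (g b)"
proof -
  let ?T = "{z. Im (g a) \<le> Im z} \<inter> {z. Im z \<le> Im (g b)}"
  have "closed ?T"
    by (intro closed_Int closed_Collect_le continuous_intros)
  then have "Sigma_set g \<subseteq> ?T"
    using assms(1) unfolding Sigma_set_def admissible_potential_def symb_def
    by (intro closure_minimal) auto
  then have "z \<in> interior ?T"
    using assms(2) interior_mono by blast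
  then obtain e where e: "0 < e" "ball z e \<subseteq> ?T"
    unfolding mem_interior by blast
  have "z + \<i> * of_real (e/2) \<in> ball z e" "z - \<i> * of_real (e/2) \<in> ball z e"
    using \<open>0 < e\<close> by (auto simp: dist_norm norm_mult)
  then have "z + \<i> * of_real (e/2) \<in> ?T" "z - \<i> * of_real (e/2) \<in> ?T"
    using e by blast+
  then show "Im (g a) < Im z" "Im z < Im (g b)"
    using \<open>0 < e\<close> by auto
qed

text \<open>Compactness of the closure turns the pointwise strict inequalities into a uniform gap to
  the critical values, which keeps both preimages of \<open>Im z\<close> away from \<open>a\<close>
  and \<open>b\<close>.\<close>

lemma admissible_domain_Im_bounds:
  assumes "admissible_potential g a b" "admissible_domain g \<Omega>" "\<Omega> \<noteq> {}"
  obtains m n where "Im (g a) < m" "m \<le> n" "n < Im (g b)" "\<And>z. z \<in> \<Omega> \<Longrightarrow> Im z \<in> {m..n}"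
proof -
  have cpt: "compact (closure \<Omega>)" "closure \<Omega> \<noteq> {}" and sub: "closure \<Omega> \<subseteq> interior (Sigma_set g)"
    using assms by (auto simp: admissible_domain_def)
  obtain z1 where z1: "z1 \<in> closure \<Omega>" "\<And>z. z \<in> closure \<Omega> \<Longrightarrow> Im z1 \<le> Im z"
    using continuous_attains_inf[OF cpt, of Im] continuous_on_Im[OF continuous_on_id] by auto
  obtain z2 where z2: "z2 \<in> closure \<Omega>" "\<And>z. z \<in> closure \<Omega> \<Longrightarrow> Im z \<le> Im z2"
    using continuous_attains_sup[OF cpt, of Im] continuous_on_Im[OF continuous_on_id] by auto
  show thesis
    using that[of "Im z1" "Im z2"] z1 z2 closure_subset[of \<Omega>]
      interior_Sigma_set[OF assms(1)] sub by (auto simp: subset_iff)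
qed

text \<open>Each open interval lies between neighbouring critical points, so \<open>q1\<close> has
  no zero there and keeps one sign. The sign is read off from the increment over the whole interval,
  as \<open>a\<close> is a global minimum and \<open>b\<close> a global maximum.\<close>

lemma admissible_potential_sign:
  assumes pot: "admissible_potential g a b"
    and q: "\<And>x. ((\<lambda>t. Im (g t)) has_real_derivative q1 x) (at x)"
    and cont: "continuous_on UNIV q1"
  shows "a < x \<Longrightarrow> x < b \<Longrightarrow> 0 < q1 x" and "b - 2 * pi < x \<Longrightarrow> x < a \<Longrightarrow> q1 x < 0"
proof -
  let ?q = "\<lambda>t. Im (g t)"
  have ab: "b - 2 * pi < a" "a < b" and per: "periodic g"
    and bd: "\<And>x. ?q a \<le> ?q x" "\<And>x. ?q x \<le> ?q b"
    using pot by (auto simp: admissible_potential_def)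
  have "q1 x = deriv ?q x" for x
    using DERIV_imp_deriv[OF q] by simp
  then have crit: "q1 x = 0 \<longleftrightarrow> (\<exists>k::int. x = a + 2 * pi * k \<or> x = b + 2 * pi * k)" for x
    using pot by (auto simp: admissible_potential_def set_eq_iff)
  \<comment> \<open>Multiples of 2\<pi> avoid the open interval from 0 to 2\<pi>. Used for
    \<open>k\<close> and its two neighbours, this leaves no translate of \<open>a\<close> or
    \<open>b\<close> in either interval.\<close>
  have gap: "2 * pi * of_int k \<le> 0 \<or> 2 * pi \<le> 2 * pi * of_int k" for k :: int
    by (cases "k \<le> 0") (auto simp: mult_le_0_iff)
  have no: "q1 x \<noteq> 0" if "a < x \<and> x < b \<or> b - 2 * pi < x \<and> x < a" for x
  proof
    assume "q1 x = 0"
    then obtain k :: int where k: "x = a + 2 * pi * k \<or> x = b + 2 * pi * k"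
      using crit by auto
    show False
      using gap[of k] gap[of "k + 1"] gap[of "k - 1"] k that ab
      unfolding of_int_add of_int_diff of_int_1 distrib_left right_diff_distrib mult_1_right by linarith
  qed
  have sgn: "0 < q1 x * q1 y"
    if "{x..y} \<subseteq> {a<..<b} \<or> {x..y} \<subseteq> {b-2*pi<..<a}" "x \<le> y" for x y
  proof (rule ccontr)
    assume "\<not> 0 < q1 x * q1 y"
    then have "q1 x \<le> 0 \<and> 0 \<le> q1 y \<or> 0 \<le> q1 x \<and> q1 y \<le> 0"
      by (auto simp: not_less mult_le_0_iff)
    moreover have "continuous_on {x..y} q1"
      using cont continuous_on_subset by blast
    ultimately have "\<exists>u. x \<le> u \<and> u \<le> y \<and> q1 u = 0"
      using IVT'[of q1 x 0 y] IVT2'[of q1 y 0 x] \<open>x \<le> y\<close> by auto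
    then obtain u where "x \<le> u" "u \<le> y" "q1 u = 0"
      by auto
    then show False
      using no[of u] that by (auto simp: subset_iff)
  qed
  have mv: "\<exists>u. x < u \<and> u < y \<and> ?q y - ?q x = (y - x) * q1 u" if "x < y" for x y
    using MVT2[OF that, of ?q q1] q by auto
  { assume x: "a < x" "x < b"
    obtain u where u: "a < u" "u < b" "?q b - ?q a = (b - a) * q1 u"
      using mv[OF ab(2)] by auto
    have "0 \<le> ?q b - ?q a"
      using bd by simp
    then have "0 \<le> q1 u"
      using u(3) ab by (simp add: zero_le_mult_iff)
    moreover have "0 < q1 x * q1 u"
      using sgn[of x u] sgn[of u x] u(1,2) x
      by (cases "x \<le> u") (simp_all add: mult.commute atLeastatMost_subset_iff subset_iff)
    ultimately show "0 < q1 x"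
      by (simp add: zero_less_mult_iff) }
  { assume x: "b - 2 * pi < x" "x < a"
    obtain u where u: "b - 2 * pi < u" "u < a" "?q a - ?q (b - 2 * pi) = (a - (b - 2 * pi)) * q1 u"
      using mv[OF ab(1)] by auto
    have "?q a - ?q (b - 2 * pi) \<le> 0"
      using bd by simp
    then have "q1 u \<le> 0"
      using u(3) ab by (simp add: mult_le_0_iff)
    moreover have "0 < q1 x * q1 u"
      using sgn[of x u] sgn[of u x] u(1,2) x
      by (cases "x \<le> u") (simp_all add: mult.commute atLeastatMost_subset_iff subset_iff)
    ultimately show "q1 x < 0"
      by (simp add: zero_less_mult_iff) }
qed

lemma inverse_diff_le:
  fixes x y l D :: real
  assumes "0 < l" "l \<le> x" "l \<le> y" "\<bar>x - y\<bar> \<le> D"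
  shows "\<bar>1 / x - 1 / y\<bar> \<le> D / l\<^sup>2"
proof -
  have "\<bar>1 / x - 1 / y\<bar> = \<bar>x - y\<bar> / (x * y)"
    using assms by (simp add: field_simps abs_minus_commute abs_mult)
  also have "\<dots> \<le> D / l\<^sup>2"
    unfolding power2_eq_square using assms by (intro frac_le mult_mono) auto
  finally show ?thesis .
qed

lemma sigma_weight_regular:
  assumes pot: "admissible_potential g a b" and dom: "admissible_domain g \<Omega>"
  obtains S l u L where "0 < l" "\<And>z. z \<in> \<Omega> \<Longrightarrow> sigma_weight g a b z = of_real (S z)"
    "\<And>z. z \<in> \<Omega> \<Longrightarrow> l \<le> S z \<and> S z \<le> u"
    "\<And>z w. z \<in> \<Omega> \<Longrightarrow> w \<in> \<Omega> \<Longrightarrow> \<bar>S z - S w\<bar> \<le> L * cmod (z - w)"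
proof (cases "\<Omega> = {}")
  case True
  \<comment> \<open>Without points there are no extreme values of \<open>Im z\<close>, and any
    positive \<open>l\<close> will do.\<close>
  then show thesis
    by (intro that[of 1 "\<lambda>_. 0"]) auto
next
  case False
  obtain m n where mn: "Im (g a) < m" "m \<le> n" "n < Im (g b)" "\<And>z. z \<in> \<Omega> \<Longrightarrow> Im z \<in> {m..n}"
    using admissible_domain_Im_bounds[OF pot dom False] by metis
  have ab: "b - 2 * pi < a" "a < b" and per: "periodic g" and sm: "smooth_on UNIV g"
    using pot by (auto simp: admissible_potential_def)
  obtain g1 g2 where g: "\<And>x. (g has_vector_derivative g1 x) (at x)"
    "\<And>x. (g1 has_vector_derivative g2 x) (at x)" "continuous_on UNIV g2"
    using smooth_on_UNIV_derivatives[OF sm] by metis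
  define q q1 q2 where "q = (\<lambda>x. Im (g x))" and "q1 = (\<lambda>x. Im (g1 x))" and "q2 = (\<lambda>x. Im (g2 x))"
  have q: "(q has_real_derivative q1 x) (at x)" "(q1 has_real_derivative q2 x) (at x)" for x
    unfolding q_def q1_def q2_def has_real_derivative_iff_has_vector_derivative
    by (auto intro!: bounded_linear.has_vector_derivative[OF bounded_linear_Im] g)
  have q1: "continuous_on UNIV q1"
    using q(2) by (meson DERIV_continuous_on has_field_derivative_at_within)
  have q2: "continuous_on UNIV q2"
    unfolding q2_def using g by (intro continuous_intros)
  have sgn: "a < x \<Longrightarrow> x < b \<Longrightarrow> 0 < q1 x" "b - 2 * pi < x \<Longrightarrow> x < a \<Longrightarrow> q1 x < 0" for x
    using admissible_potential_sign[OF pot q(1)[unfolded q_def] q1] by blast+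
  have dq: "deriv (\<lambda>t. Im (g t)) x = q1 x" for x
    using q by (simp add: DERIV_imp_deriv q_def)
  have "g (b - 2 * pi) = g b"
    using per unfolding periodic_def by (metis diff_add_cancel)
  then have ends: "q a < m" "n < q b" "- q (b - 2 * pi) < - n" "- m < - q a"
    using mn by (auto simp: q_def)
  \<comment> \<open>The branch to the left of \<open>a\<close> is decreasing; \<open>- q\<close> is
    increasing there, with relevant values in \<open>{-n..-m}\<close>.\<close>
  note mq = DERIV_minus[OF q(1)] DERIV_minus[OF q(2)]
  obtain l L where l: "0 < l" "\<forall>y\<in>{m..n}. \<exists>!x. a < x \<and> x < b \<and> q x = y"
    "\<forall>x\<in>{a<..<b}. q x \<in> {m..n} \<longrightarrow> l \<le> q1 x \<and> q1 x \<le> L"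
    "\<forall>x\<in>{a<..<b}. \<forall>x'\<in>{a<..<b}. q x \<in> {m..n} \<longrightarrow> q x' \<in> {m..n} \<longrightarrow>
       \<bar>q1 x - q1 x'\<bar> \<le> L * \<bar>q x - q x'\<bar>"
    using branch_regularity[OF q q2 sgn(1) ab(2) ends(1) mn(2) ends(2)] by blast
  obtain k K where k: "0 < k" "\<forall>y\<in>{-n..-m}. \<exists>!x. b - 2 * pi < x \<and> x < a \<and> - q x = y"
    "\<forall>x\<in>{b-2*pi<..<a}. - q x \<in> {-n..-m} \<longrightarrow> k \<le> - q1 x \<and> - q1 x \<le> K"
    "\<forall>x\<in>{b-2*pi<..<a}. \<forall>x'\<in>{b-2*pi<..<a}. - q x \<in> {-n..-m} \<longrightarrow> - q x' \<in> {-n..-m} \<longrightarrow>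
       \<bar>- q1 x - - q1 x'\<bar> \<le> K * \<bar>- q x - - q x'\<bar>"
    using branch_regularity[OF mq continuous_on_minus[OF q2] _ ab(1) ends(3) _ ends(4)] sgn(2) mn(2)
    by (simp only: neg_0_less_iff_less neg_le_iff_le) blast
  define X Y where "X = x_minus g a b" and "Y = x_plus g a b"
  have X: "a < X z \<and> X z < b \<and> q (X z) = Im z" if "z \<in> \<Omega>" for z
  proof -
    \<comment> \<open>The sign condition on the derivative holds along the whole branch, so it drops
      out of the description and only the uniqueness of the preimage remains.\<close>
    have "X z = (THE x. a < x \<and> x < b \<and> q x = Im z)"
      unfolding X_def x_minus_def dq by (rule arg_cong[of _ _ The]) (use sgn in \<open>auto simp: q_def\<close>)
    then show ?thesis
      using theI'[OF l(2)[rule_format, OF mn(4)[OF that]]] by simp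
  qed
  have Y: "b - 2 * pi < Y z \<and> Y z < a \<and> q (Y z) = Im z" if "z \<in> \<Omega>" for z
  proof -
    have "Y z = (THE x. b - 2 * pi < x \<and> x < a \<and> - q x = - Im z)"
      unfolding Y_def x_plus_def dq by (rule arg_cong[of _ _ The]) (use sgn in \<open>auto simp: q_def\<close>)
    then show ?thesis
      using theI'[OF k(2)[rule_format], of "- Im z"] mn(4)[OF that] by simp
  qed
  have bX: "l \<le> q1 (X z)" "q1 (X z) \<le> L" and bY: "k \<le> - q1 (Y z)" "- q1 (Y z) \<le> K" if "z \<in> \<Omega>" for z
    using l(3)[rule_format, of "X z"] k(3)[rule_format, of "Y z"] X[OF that] Y[OF that] mn(4)[OF that] by auto
  show thesis
  \<comment> \<open>Large slopes make the weight small: its lower bound comes from the upper bounds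
    \<open>L\<close> and \<open>K\<close> of the slopes, its upper bound from \<open>l\<close> and
    \<open>k\<close>. Taking reciprocals divides the Lipschitz constants by the squares of
    \<open>l\<close> and \<open>k\<close>.\<close>
  proof (rule that[of "1 / L + 1 / K" "\<lambda>z. 1 / q1 (X z) + 1 / (- q1 (Y z))" "1 / l + 1 / k" "L / l\<^sup>2 + K / k\<^sup>2"])
    \<comment> \<open>Positivity of \<open>L\<close> and \<open>K\<close> is known only through an
      actual slope.\<close>
    obtain z where "z \<in> \<Omega>"
      using False by auto
    then have "0 < L" "0 < K"
      using bX[of z] bY[of z] l(1) k(1) by linarith+
    then show "0 < 1 / L + 1 / K"
      by (simp add: add_pos_pos)
    show "sigma_weight g a b z = of_real (1 / q1 (X z) + 1 / (- q1 (Y z)))" if "z \<in> \<Omega>" for z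
      unfolding sigma_weight_def rho_plus_def rho_minus_def
        poisson_bracket_symb(1)[OF g(1)] poisson_bracket_symb(2)[OF g(1)]
      by (simp add: q1_def X_def Y_def divide_simps)
    show "1 / L + 1 / K \<le> 1 / q1 (X z) + 1 / (- q1 (Y z)) \<and>
        1 / q1 (X z) + 1 / (- q1 (Y z)) \<le> 1 / l + 1 / k" if "z \<in> \<Omega>" for z
      using bX[OF that] bY[OF that] l(1) k(1)
      by (intro conjI add_mono frac_le) auto
    show "\<bar>1 / q1 (X z) + 1 / (- q1 (Y z)) - (1 / q1 (X w) + 1 / (- q1 (Y w)))\<bar>
        \<le> (L / l\<^sup>2 + K / k\<^sup>2) * cmod (z - w)" if zw: "z \<in> \<Omega>" "w \<in> \<Omega>" for z w
    proof -
      \<comment> \<open>\<open>X z\<close> and \<open>Y z\<close> depend on \<open>z\<close> only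
        through \<open>Im z\<close>.\<close>
      have im: "\<bar>Im z - Im w\<bar> \<le> cmod (z - w)"
        using abs_Im_le_cmod[of "z - w"] by simp
      have "\<bar>q1 (X z) - q1 (X w)\<bar> \<le> L * \<bar>Im z - Im w\<bar>"
        using l(4)[rule_format, of "X z" "X w"] X[OF zw(1)] X[OF zw(2)] mn(4)[OF zw(1)] mn(4)[OF zw(2)] by simp
      then have 1: "\<bar>q1 (X z) - q1 (X w)\<bar> \<le> L * cmod (z - w)"
        using mult_left_mono[OF im, of L] \<open>0 < L\<close> by linarith
      have "\<bar>- q1 (Y z) - - q1 (Y w)\<bar> \<le> K * \<bar>Im z - Im w\<bar>"
        using k(4)[rule_format, of "Y z" "Y w"] Y[OF zw(1)] Y[OF zw(2)] mn(4)[OF zw(1)] mn(4)[OF zw(2)]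
        by (simp add: abs_minus_commute)
      then have 2: "\<bar>- q1 (Y z) - - q1 (Y w)\<bar> \<le> K * cmod (z - w)"
        using mult_left_mono[OF im, of K] \<open>0 < K\<close> by linarith
      from inverse_diff_le[OF l(1) _ _ 1] inverse_diff_le[OF k(1) _ _ 2]
      show ?thesis
        using bX[OF zw(1)] bX[OF zw(2)] bY[OF zw(1)] bY[OF zw(2)] by (simp add: algebra_simps)
    qed
  qed
qed

section \<open>The limiting pair correlation\<close>

text \<open>At \<open>k = 0\<close> the numerator behaves like 1 + 1 - 2, so it vanishes although
  its terms do not; this makes the first quotient regular. The other three bounds concern the
  coefficients that multiply error terms, where no cancellation helps and the size is
  \<open>1 / k\<close>.\<close>

lemma pair_function_near_zero:
  obtains A k0 :: real where "0 < A" "0 < k0"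
    "\<And>k. 0 < k \<Longrightarrow> k < k0 \<Longrightarrow>
       \<bar>(1 + exp (- 2 * k) + (2 * k\<^sup>2 * coth k - 4 * k) / (exp k * sinh k)) / (1 - exp (- 2 * k)) - k\<bar> \<le> A * k\<^sup>2 \<and>
       \<bar>exp (- 2 * k) / (1 - exp (- 2 * k))\<bar> \<le> A / k \<and>
       \<bar>(2 * k\<^sup>2 * coth k - 4 * k) / (exp k * sinh k) / (1 - exp (- 2 * k))\<bar> \<le> A / k \<and>
       \<bar>1 / (1 - exp (- 2 * k))\<bar> \<le> A / k"
proof -
  have "(\<lambda>k::real. (1 + exp (- 2 * k) + (2 * k\<^sup>2 * coth k - 4 * k) / (exp k * sinh k)) / (1 - exp (- 2 * k)) - k)
      \<in> O[at_right 0](\<lambda>k. k\<^sup>2)"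
    unfolding coth_def by real_asymp
  then obtain A1 where A1: "0 < A1" "\<forall>\<^sub>F k::real in at_right 0.
      norm ((1 + exp (- 2 * k) + (2 * k\<^sup>2 * coth k - 4 * k) / (exp k * sinh k)) / (1 - exp (- 2 * k)) - k) \<le> A1 * norm (k\<^sup>2)"
    by (elim landau_o.bigE)
  have "(\<lambda>k::real. exp (- 2 * k) / (1 - exp (- 2 * k))) \<in> O[at_right 0](\<lambda>k. 1 / k)"
    by real_asymp
  then obtain A2 where A2: "0 < A2" "\<forall>\<^sub>F k::real in at_right 0.
      norm (exp (- 2 * k) / (1 - exp (- 2 * k))) \<le> A2 * norm (1 / k)"
    by (elim landau_o.bigE)
  have "(\<lambda>k::real. (2 * k\<^sup>2 * coth k - 4 * k) / (exp k * sinh k) / (1 - exp (- 2 * k))) \<in> O[at_right 0](\<lambda>k. 1 / k)"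
    unfolding coth_def by real_asymp
  then obtain A3 where A3: "0 < A3" "\<forall>\<^sub>F k::real in at_right 0.
      norm ((2 * k\<^sup>2 * coth k - 4 * k) / (exp k * sinh k) / (1 - exp (- 2 * k))) \<le> A3 * norm (1 / k)"
    by (elim landau_o.bigE)
  have "(\<lambda>k::real. 1 / (1 - exp (- 2 * k))) \<in> O[at_right 0](\<lambda>k. 1 / k)"
    by real_asymp
  then obtain A4 where A4: "0 < A4" "\<forall>\<^sub>F k::real in at_right 0.
      norm (1 / (1 - exp (- 2 * k))) \<le> A4 * norm (1 / k)"
    by (elim landau_o.bigE)
  define A where "A = A1 + A2 + A3 + A4"
  have A: "0 < A" "A1 \<le> A" "A2 \<le> A" "A3 \<le> A" "A4 \<le> A"
    using A1(1) A2(1) A3(1) A4(1) by (simp_all add: A_def)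
  have "\<forall>\<^sub>F k in at_right 0.
       \<bar>(1 + exp (- 2 * k) + (2 * k\<^sup>2 * coth k - 4 * k) / (exp k * sinh k)) / (1 - exp (- 2 * k)) - k\<bar> \<le> A * k\<^sup>2 \<and>
       \<bar>exp (- 2 * k) / (1 - exp (- 2 * k))\<bar> \<le> A / k \<and>
       \<bar>(2 * k\<^sup>2 * coth k - 4 * k) / (exp k * sinh k) / (1 - exp (- 2 * k))\<bar> \<le> A / k \<and>
       \<bar>1 / (1 - exp (- 2 * k))\<bar> \<le> A / k"
    using A1(2) A2(2) A3(2) A4(2) eventually_at_right_less[of "0::real"]
  proof eventually_elim
    case (elim k)
    have "B * norm (1 / k) \<le> A / k" if "B \<le> A" for B
      using that elim(5) by (simp add: divide_right_mono)
    moreover have "A1 * norm (k\<^sup>2) \<le> A * k\<^sup>2"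
      using A by (simp add: mult_right_mono)
    ultimately show ?case
      using elim(1-4) A unfolding real_norm_def by (meson order_trans)
  qed
  then show thesis
    using that A(1) unfolding eventually_at_right_field by blast
qed

text \<open>The fraction has size \<open>k^2 * exp (- 2 * k)\<close>; half of the exponent pays for
  the polynomial factor. The bound \<open>1 / 2\<close> keeps \<open>1 - exp (- 2 * k)\<close> away
  from zero.\<close>

lemma pair_function_at_infinity:
  obtains A k1 :: real where "0 < A"
    "\<And>k. k1 \<le> k \<Longrightarrow> \<bar>(2 * k\<^sup>2 * coth k - 4 * k) / (exp k * sinh k)\<bar> \<le> A * exp (- k) \<and> exp (- 2 * k) \<le> 1 / 2"
proof -
  have "(\<lambda>k::real. (2 * k\<^sup>2 * coth k - 4 * k) / (exp k * sinh k)) \<in> O(\<lambda>k. exp (- k))"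
    unfolding coth_def by real_asymp
  then obtain A where A: "0 < A" "\<forall>\<^sub>F k::real in at_top.
      norm ((2 * k\<^sup>2 * coth k - 4 * k) / (exp k * sinh k)) \<le> A * norm (exp (- k))"
    by (elim landau_o.bigE)
  have "\<forall>\<^sub>F k::real in at_top. exp (- 2 * k) \<le> 1 / 2"
    by real_asymp
  with A(2) have "\<forall>\<^sub>F k::real in at_top.
      \<bar>(2 * k\<^sup>2 * coth k - 4 * k) / (exp k * sinh k)\<bar> \<le> A * exp (- k) \<and> exp (- 2 * k) \<le> 1 / 2"
    by eventually_elim simp
  then show thesis
    using that A(1) unfolding eventually_at_top_linorder by blast
qed

section \<open>Division by the one-point densities\<close>

lemma inverse_product_close_to_one:
  fixes u v e :: real
  assumes "\<bar>u - 1\<bar> \<le> e" "\<bar>v - 1\<bar> \<le> e" "e \<le> 1 / 2"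
  shows "0 < u * v" "1 / (u * v) \<le> 4" "\<bar>1 / (u * v) - 1\<bar> \<le> 10 * e"
proof -
  have e: "0 \<le> e" "1 / 2 \<le> u" "1 / 2 \<le> v" "u \<le> 3 / 2"
    using assms by linarith+
  have uv: "1 / 4 \<le> u * v"
    using mult_mono[of "1/2" u "1/2" v] e by simp
  then show "0 < u * v"
    by linarith
  then show le: "1 / (u * v) \<le> 4"
    using uv by (simp add: field_simps)
  have "\<bar>u * v - 1\<bar> = \<bar>u * (v - 1) + (u - 1)\<bar>"
    by (simp add: algebra_simps)
  also have "\<dots> \<le> u * \<bar>v - 1\<bar> + \<bar>u - 1\<bar>"
    using e by (intro order_trans[OF abs_triangle_ineq]) (simp add: abs_mult)
  also have "\<dots> \<le> 3 / 2 * e + e"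
    using assms e by (intro add_mono mult_mono) auto
  finally have "\<bar>u * v - 1\<bar> \<le> 5 / 2 * e"
    by simp
  moreover have "\<bar>1 / (u * v) - 1\<bar> = 1 / (u * v) * \<bar>u * v - 1\<bar>"
  proof -
    have "1 / (u * v) - 1 = 1 / (u * v) * (1 - u * v)"
      using less_imp_neq[OF \<open>0 < u * v\<close>] by (auto simp: right_diff_distrib)
    then show ?thesis
      using \<open>0 < u * v\<close> by (simp only: abs_mult abs_of_pos zero_less_divide_1_iff abs_minus_commute)
  qed
  \<comment> \<open>The constant 10 is 4, the bound of the reciprocal, times 5/2.\<close>
  ultimately show "\<bar>1 / (u * v) - 1\<bar> \<le> 10 * e"
    using mult_mono[OF le \<open>\<bar>u * v - 1\<bar> \<le> 5 / 2 * e\<close>] by simp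
qed

text \<open>Pure algebra of the normalisation. \<open>P\<close> stands for the product of the
  diagonal weights, \<open>n\<close> for the squared off-diagonal weight, \<open>c\<close> for
  \<open>(2 * pi * h)^2\<close>, \<open>E\<close> for \<open>1 - exp (- 2 * k)\<close>, and
  \<open>c * (1 / P) * i\<close> for the reciprocal of the product of the densities.\<close>

lemma normalise_expansion:
  fixes P :: real
  assumes "P \<noteq> 0" "c \<noteq> 0"
  shows "((P + n * x * e + n * y * G + r3 + r4) / (c * E) * q + r6) * (c * (1 / P) * i)
    = i * q / E * (1 + n / P * x * e + n / P * y * G + r3 * (1 / P) + r4 * (1 / P)) + r6 * (c * (1 / P) * i)"
proof -
  have "a / (c * E) * q * (c * (1 / P) * i) = i * q / E * (a * (1 / P))" for a
    using \<open>c \<noteq> 0\<close> by simp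
  moreover have "(P + n * x * e + n * y * G + r3 + r4) * (1 / P)
      = 1 + n / P * x * e + n / P * y * G + r3 * (1 / P) + r4 * (1 / P)"
    using \<open>P \<noteq> 0\<close> by (simp add: add_divide_distrib)
  ultimately show ?thesis
    by (simp only: distrib_right)
qed

text \<open>A density with leading term \<open>s / (2 * pi * h)\<close> and error O(1) is this term
  times 1 + O(h). The powers of \<open>2 * pi * h\<close> cancel, \<open>r5\<close> joins
  \<open>s0\<close>, and the ratio \<open>(szw p)^2 / (sz p * sw p)\<close>, which is 1 + O(t), is
  absorbed by \<open>s1\<close> and \<open>s2\<close>. The errors \<open>r3\<close>,
  \<open>r4\<close> and \<open>r6\<close> are only multiplied by bounded functions, so they keep
  whatever class they have.\<close>

lemma normalised_two_point_expansion:
  fixes F :: "'p filter" and h t sz sw szw dz dw k d2 r1 r2 r3 r4 r5 r6 :: "'p \<Rightarrow> real"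
  assumes h: "(h \<longlongrightarrow> 0) F" "\<forall>\<^sub>F p in F. 0 < h p"
    and l: "0 < l" "\<forall>\<^sub>F p in F. l \<le> sz p \<and> l \<le> sw p"
    and szw: "(\<lambda>p. (szw p)\<^sup>2 - sz p * sw p) \<in> O[F](t)" and t: "t \<in> O[F](\<lambda>_. 1)"
    and dz: "(\<lambda>p. dz p - sz p / (2 * pi * h p)) \<in> O[F](\<lambda>_. 1)"
    and dw: "(\<lambda>p. dw p - sw p / (2 * pi * h p)) \<in> O[F](\<lambda>_. 1)"
    and r: "r1 \<in> O[F](t)" "r2 \<in> O[F](t)" "r5 \<in> O[F](h)"
    and d2: "\<forall>\<^sub>F p in F. d2 p =
      (sz p * sw p + (szw p)\<^sup>2 * (1 + r1 p) * exp (- 2 * k p)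
         + (szw p)\<^sup>2 * (1 + r2 p) / (exp (k p) * sinh (k p)) * (2 * (k p)\<^sup>2 * coth (k p) - 4 * k p) + r3 p + r4 p)
       / ((2 * pi * h p)\<^sup>2 * (1 - exp (- 2 * k p))) * (1 + r5 p) + r6 p"
  shows "\<exists>s0 s1 s2 s3 s4 s5. s0 \<in> O[F](h) \<and> s1 \<in> O[F](t) \<and> s2 \<in> O[F](t) \<and>
     s3 \<in> O[F](r3) \<and> s4 \<in> O[F](r4) \<and> s5 \<in> O[F](r6) \<and>
     (\<forall>\<^sub>F p in F. d2 p / (dw p * dz p) =
        (1 + s0 p) / (1 - exp (- 2 * k p)) *
          (1 + (1 + s1 p) * exp (- 2 * k p)
             + (1 + s2 p) / (exp (k p) * sinh (k p)) * (2 * (k p)\<^sup>2 * coth (k p) - 4 * k p)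
             + s3 p + s4 p)
        + s5 p)"
proof -
  have h1: "h \<in> O[F](\<lambda>_. 1)"
    using h(1) by (intro bigoI_tendsto[where c = 0]) auto
  have inv_le: "1 / x \<le> 1 / l" if "l \<le> x" for x
    using that l by (simp add: frac_le)
  have inv: "(\<lambda>p. 1 / sz p) \<in> O[F](\<lambda>_. 1)" "(\<lambda>p. 1 / sw p) \<in> O[F](\<lambda>_. 1)"
    by (rule bigoI[where c = "1 / l"], use l(2) in eventually_elim, use l(1) inv_le in force)+
  have iss: "(\<lambda>p. 1 / (sz p * sw p)) \<in> O[F](\<lambda>_. 1)"
    using landau_o.big.mult[OF inv] by (simp only: mult_1 times_divide_times_eq)
  have near1: "(\<lambda>p. 2 * pi * h p * d p / s p - 1) \<in> O[F](h)"
    if d: "(\<lambda>p. d p - s p / (2 * pi * h p)) \<in> O[F](\<lambda>_. 1)" and s: "(\<lambda>p. 1 / s p) \<in> O[F](\<lambda>_. 1)"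
      and l: "\<forall>\<^sub>F p in F. l \<le> s p" for d s
  proof (rule landau_o.big.in_cong[THEN iffD2])
    show "\<forall>\<^sub>F p in F. 2 * pi * h p * d p / s p - 1 = h p * ((d p - s p / (2 * pi * h p)) * (1 / s p) * (2 * pi))"
      using h(2) l
    proof eventually_elim
      case (elim p)
      then have "0 < s p"
        using \<open>0 < l\<close> by simp
      with elim show ?case
        by (simp add: field_simps)
    qed
    have "(\<lambda>_. 2 * pi) \<in> O[F](\<lambda>_. 1)"
      by simp
    from landau_o.big.mult[OF landau_o.big_refl[of h F] landau_o.big.mult[OF landau_o.big.mult[OF d s] this]]
    show "(\<lambda>p. h p * ((d p - s p / (2 * pi * h p)) * (1 / s p) * (2 * pi))) \<in> O[F](h)"
      by (simp only: mult_1_right)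
  qed
  define u v where "u p = 2 * pi * h p * dz p / sz p" and "v p = 2 * pi * h p * dw p / sw p" for p
  have ou: "(\<lambda>p. u p - 1) \<in> O[F](h)" and ov: "(\<lambda>p. v p - 1) \<in> O[F](h)"
    unfolding u_def v_def using l(2)
    by (auto intro!: near1 dz dw inv elim: eventually_mono)
  obtain A where A: "0 < A" "\<forall>\<^sub>F p in F. \<bar>u p - 1\<bar> \<le> A * \<bar>h p\<bar>"
    using ou by (elim landau_o.bigE) auto
  obtain B where B: "0 < B" "\<forall>\<^sub>F p in F. \<bar>v p - 1\<bar> \<le> B * \<bar>h p\<bar>"
    using ov by (elim landau_o.bigE) auto
  \<comment> \<open>Below this threshold \<open>max A B * h p\<close> is at most 1/2, as required
    for the reciprocal of \<open>u p * v p\<close>.\<close>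
  have "\<forall>\<^sub>F p in F. h p < 1 / (2 * max A B)"
    using order_tendstoD(2)[OF h(1)] A(1) by simp
  with A(2) B(2) h(2) have uv: "\<forall>\<^sub>F p in F. 0 < u p * v p \<and> 1 / (u p * v p) \<le> 4 \<and>
      \<bar>1 / (u p * v p) - 1\<bar> \<le> 10 * (max A B * h p)"
  proof eventually_elim
    case (elim p)
    have "A * h p \<le> max A B * h p" "B * h p \<le> max A B * h p"
      using elim by (simp_all add: mult_right_mono)
    moreover have "\<bar>u p - 1\<bar> \<le> A * h p" "\<bar>v p - 1\<bar> \<le> B * h p"
      using elim by simp_all
    ultimately have "\<bar>u p - 1\<bar> \<le> max A B * h p" "\<bar>v p - 1\<bar> \<le> max A B * h p"
      using order_trans by blast+
    moreover have "max A B * h p \<le> 1 / 2"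
      using elim A(1) by (simp add: field_simps)
    ultimately show ?case
      using inverse_product_close_to_one by blast
  qed
  have iuv: "(\<lambda>p. 1 / (u p * v p)) \<in> O[F](\<lambda>_. 1)"
    by (rule bigoI[where c = 4], use uv in eventually_elim) auto
  have uv1: "(\<lambda>p. 1 / (u p * v p) - 1) \<in> O[F](h)"
    by (rule bigoI[where c = "10 * max A B"], use uv h(2) in eventually_elim) auto
  have q: "(\<lambda>p. (szw p)\<^sup>2 / (sz p * sw p) - 1) \<in> O[F](t)"
  proof (rule landau_o.big.in_cong[THEN iffD2])
    show "\<forall>\<^sub>F p in F. (szw p)\<^sup>2 / (sz p * sw p) - 1 = ((szw p)\<^sup>2 - sz p * sw p) * (1 / (sz p * sw p))"
      using l(2) by eventually_elim (use l(1) in \<open>auto simp: field_simps\<close>)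
    show "(\<lambda>p. ((szw p)\<^sup>2 - sz p * sw p) * (1 / (sz p * sw p))) \<in> O[F](t)"
      using landau_o.big.mult[OF szw iss] by simp
  qed
  have q1: "(\<lambda>p. (szw p)\<^sup>2 / (sz p * sw p)) \<in> O[F](\<lambda>_. 1)"
    using sum_in_bigo(1)[OF landau_o.big_trans[OF q t], of "\<lambda>_. 1"] by simp
  have affine: "(\<lambda>p. x p * (1 + f p) - 1) \<in> O[F](m)"
    if "(\<lambda>p. x p - 1) \<in> O[F](m)" "x \<in> O[F](\<lambda>_. 1)" "f \<in> O[F](m)" for x f m :: "'p \<Rightarrow> real"
  proof -
    have "x p * (1 + f p) - 1 = (x p - 1) + x p * f p" for p
      by (simp add: distrib_left)
    then show ?thesis
      using sum_in_bigo(1)[OF that(1) landau_o.big.mult[OF that(2,3), unfolded mult_1]] by presburger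
  qed
  define s0 s1 s2 where "s0 p = 1 / (u p * v p) * (1 + r5 p) - 1"
    and "s1 p = (szw p)\<^sup>2 / (sz p * sw p) * (1 + r1 p) - 1"
    and "s2 p = (szw p)\<^sup>2 / (sz p * sw p) * (1 + r2 p) - 1" for p
  \<comment> \<open>Eventually \<open>X p\<close> is the reciprocal of \<open>dw p * dz p\<close>,
    in a form that shows its boundedness.\<close>
  define X where "X p = (2 * pi * h p)\<^sup>2 * (1 / (sz p * sw p)) * (1 / (u p * v p))" for p
  have X1: "X \<in> O[F](\<lambda>_. 1)"
  proof -
    have "(\<lambda>p. 2 * pi * h p) \<in> O[F](\<lambda>_. 1)"
      using h1 by simp
    from landau_o.big.mult[OF this this] have "(\<lambda>p. (2 * pi * h p)\<^sup>2) \<in> O[F](\<lambda>_. 1)"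
      by (simp only: power2_eq_square mult_1)
    from landau_o.big.mult[OF landau_o.big.mult[OF this iss] iuv] show ?thesis
      by (simp only: X_def[abs_def] mult_1)
  qed
  have bounded: "(\<lambda>p. f p * e p) \<in> O[F](f)" if "e \<in> O[F](\<lambda>_. 1)" for f e :: "'p \<Rightarrow> real"
    using landau_o.big.mult[OF landau_o.big_refl[of f F] that] by (simp only: mult_1_right)
  show ?thesis
  proof (intro exI conjI)
    show "s0 \<in> O[F](h)" "s1 \<in> O[F](t)" "s2 \<in> O[F](t)"
      unfolding s0_def[abs_def] s1_def[abs_def] s2_def[abs_def]
      by (rule affine[OF uv1 iuv r(3)] affine[OF q q1 r(1)] affine[OF q q1 r(2)])+
    show "(\<lambda>p. r3 p * (1 / (sz p * sw p))) \<in> O[F](r3)" "(\<lambda>p. r4 p * (1 / (sz p * sw p))) \<in> O[F](r4)"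
      "(\<lambda>p. r6 p * X p) \<in> O[F](r6)"
      by (rule bounded[OF iss] bounded[OF X1])+
    show "\<forall>\<^sub>F p in F. d2 p / (dw p * dz p) =
        (1 + s0 p) / (1 - exp (- 2 * k p)) *
          (1 + (1 + s1 p) * exp (- 2 * k p)
             + (1 + s2 p) / (exp (k p) * sinh (k p)) * (2 * (k p)\<^sup>2 * coth (k p) - 4 * k p)
             + r3 p * (1 / (sz p * sw p)) + r4 p * (1 / (sz p * sw p)))
        + r6 p * X p"
      using d2 uv h(2) l(2)
    proof eventually_elim
      case (elim p)
      have pos: "0 < sz p" "0 < sw p" "0 < h p"
        using elim l(1) by auto
      have s: "1 + s0 p = 1 / (u p * v p) * (1 + r5 p)"
        "1 + s1 p = (szw p)\<^sup>2 / (sz p * sw p) * (1 + r1 p)"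
        "1 + s2 p = (szw p)\<^sup>2 / (sz p * sw p) * (1 + r2 p)"
        by (simp_all add: s0_def s1_def s2_def)
      define G where "G = (2 * (k p)\<^sup>2 * coth (k p) - 4 * k p) / (exp (k p) * sinh (k p))"
      have G: "y / (exp (k p) * sinh (k p)) * (2 * (k p)\<^sup>2 * coth (k p) - 4 * k p) = y * G" for y
        by (simp add: G_def)
      have "dz p \<noteq> 0" "dw p \<noteq> 0"
        using elim by (auto simp: u_def v_def)
      with pos have "1 / (dw p * dz p) = X p"
        by (simp add: X_def u_def v_def field_simps power2_eq_square)
      then have "d2 p / (dw p * dz p) = d2 p * X p"
        by (metis divide_inverse inverse_eq_divide)
      also have "\<dots> = (1 + s0 p) / (1 - exp (- 2 * k p)) *
          (1 + (1 + s1 p) * exp (- 2 * k p) + (1 + s2 p) * G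
             + r3 p * (1 / (sz p * sw p)) + r4 p * (1 / (sz p * sw p))) + r6 p * X p"
        unfolding elim(1) G s X_def by (rule normalise_expansion) (use pos in auto)
      finally show ?case
        unfolding G .
    qed
  qed
qed

text \<open>\<open>F\<close> is the unperturbed pair function and \<open>G1\<close>,
  \<open>G2\<close>, \<open>G3\<close> are the coefficients of its errors. With
  \<open>x = t^2 / h\<close>, comparable to \<open>k\<close>, every absolute error has to be O(x^2),
  because the leading term has size \<open>x\<close>. The hypothesis
  \<open>h ^ 3 \<le> t ^ 5\<close> is equivalent to \<open>t \<le> x ^ 3\<close>, which makes terms
  of size \<open>t / k\<close> small enough; as \<open>t \<le> 1\<close>, it also gives
  \<open>h \<le> x^2\<close>, which disposes of \<open>s5\<close>.\<close>

lemma short_range_bound: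
  fixes A l u :: real
  assumes "0 < A" "0 < l" "0 < u"
  obtains B where "0 < B"
    "\<And>h t \<sigma> k F G1 G2 G3 s0 s1 s2 s3 s5. 0 < h \<Longrightarrow> h \<le> 1 \<Longrightarrow> 0 < t \<Longrightarrow> t \<le> 1 \<Longrightarrow> h ^ 3 \<le> t ^ 5 \<Longrightarrow>
      l \<le> \<sigma> \<Longrightarrow> \<sigma> \<le> u \<Longrightarrow> A * t \<le> 1 / 2 \<Longrightarrow>
      \<bar>k - \<sigma> * t\<^sup>2 / (4 * h)\<bar> \<le> \<sigma> * t\<^sup>2 / (4 * h) * (A * t) \<Longrightarrow>
      \<bar>F - k\<bar> \<le> A * k\<^sup>2 \<Longrightarrow> \<bar>G1\<bar> \<le> A / k \<Longrightarrow> \<bar>G2\<bar> \<le> A / k \<Longrightarrow> \<bar>G3\<bar> \<le> A / k \<Longrightarrow>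
      \<bar>s0\<bar> \<le> A * h \<Longrightarrow> \<bar>s1\<bar> \<le> A * t \<Longrightarrow> \<bar>s2\<bar> \<le> A * t \<Longrightarrow> \<bar>s3\<bar> \<le> A * h \<Longrightarrow> \<bar>s5\<bar> \<le> A * h \<Longrightarrow>
      \<bar>((1 + s0) * (F + s1 * G1 + s2 * G2 + s3 * G3) + s5) / (\<sigma> * t\<^sup>2 / (4 * h)) - 1\<bar> \<le> B * (t\<^sup>2 / h)"
proof -
  \<comment> \<open>\<open>c1\<close> collects the error of \<open>F\<close>, with
    \<open>k \<le> u * x / 2\<close>, and three products of an error with its coefficient.
    \<open>c2\<close> adds the contributions of \<open>k - \<tau>\<close>, \<open>s0\<close> and
    \<open>s5\<close>. The final factor \<open>4 / l\<close> comes from dividing by \<tau>, which is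
    at least \<open>l * x / 4\<close>.\<close>
  define c1 where "c1 = A * u\<^sup>2 / 4 + 3 * (8 * A\<^sup>2 / l)"
  define c2 where "c2 = u * A / 4 + c1 + A * u / 2 + A * c1 + A"
  have c: "0 < c1" "0 < c2"
    using assms unfolding c2_def by (auto simp: c1_def intro!: add_pos_pos mult_pos_pos)
  show thesis
  proof (rule that[of "4 * c2 / l"])
    show "0 < 4 * c2 / l"
      using c assms by simp
  next
    fix h t \<sigma> k F G1 G2 G3 s0 s1 s2 s3 s5 :: real
    assume h: "0 < h" "h \<le> 1" and t: "0 < t" "t \<le> 1" and ht: "h ^ 3 \<le> t ^ 5"
      and \<sigma>: "l \<le> \<sigma>" "\<sigma> \<le> u" and At: "A * t \<le> 1 / 2"
      and k: "\<bar>k - \<sigma> * t\<^sup>2 / (4 * h)\<bar> \<le> \<sigma> * t\<^sup>2 / (4 * h) * (A * t)"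
      and FG: "\<bar>F - k\<bar> \<le> A * k\<^sup>2" "\<bar>G1\<bar> \<le> A / k" "\<bar>G2\<bar> \<le> A / k" "\<bar>G3\<bar> \<le> A / k"
      and s: "\<bar>s0\<bar> \<le> A * h" "\<bar>s1\<bar> \<le> A * t" "\<bar>s2\<bar> \<le> A * t" "\<bar>s3\<bar> \<le> A * h" "\<bar>s5\<bar> \<le> A * h"
    define x \<tau> where "x = t\<^sup>2 / h" and "\<tau> = \<sigma> * x / 4"
    have \<tau>: "\<sigma> * t\<^sup>2 / (4 * h) = \<tau>"
      by (simp add: \<tau>_def x_def)
    have "h ^ 3 \<le> t ^ 3"
      using ht power_decreasing[of 3 5 t] t by linarith
    then have hlet: "h \<le> t"
      using h t by (simp add: power_mono_iff)
    have x0: "0 < x"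
      using h t by (simp add: x_def)
    have tx: "t \<le> x"
      using hlet h t by (simp add: x_def field_simps power2_eq_square)
    have "h ^ 3 \<le> t ^ 4"
      using ht power_decreasing[of 4 5 t] t by linarith
    then have hx2: "h \<le> x\<^sup>2"
      using h by (simp add: x_def field_simps eval_nat_numeral)
    have "h ^ 3 * t \<le> t ^ 5 * t"
      using ht t by (intro mult_right_mono) auto
    then have tx3: "t \<le> x\<^sup>2 * x"
      using h by (simp add: x_def field_simps eval_nat_numeral)
    have \<tau>b: "l * x / 4 \<le> \<tau>" "\<tau> \<le> u * x / 4" "0 < \<tau>"
      using \<sigma> x0 assms by (simp_all add: \<tau>_def)
    have "\<tau> * (A * t) \<le> \<tau> * (1 / 2)"
      using At \<tau>b by (intro mult_left_mono) auto
    then have kb: "\<tau> / 2 \<le> k" "k \<le> 2 * \<tau>"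
      using k[unfolded \<tau>] \<tau>b by linarith+
    then have k0: "l * x / 8 \<le> k" "k \<le> u * x / 2" "0 < k"
      using \<tau>b by linarith+
    have G: "\<bar>e * G\<bar> \<le> 8 * A\<^sup>2 / l * x\<^sup>2" if "\<bar>e\<bar> \<le> A * t" "\<bar>G\<bar> \<le> A / k" for e G
    proof -
      have "\<bar>e * G\<bar> \<le> (A * t) * (A / k)"
        unfolding abs_mult using that assms t by (intro mult_mono) auto
      also have "\<dots> \<le> (A * (x\<^sup>2 * x)) * (A / (l * x / 8))"
        using tx3 k0 assms x0 t by (intro mult_mono divide_left_mono) auto
      also have "\<dots> = 8 * A\<^sup>2 / l * x\<^sup>2"
        using x0 assms by (simp add: field_simps power2_eq_square)
      finally show ?thesis .
    qed
    \<comment> \<open>Weakened to size \<open>t\<close>, the error \<open>s3\<close> falls under the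
      same estimate \<open>G\<close> as \<open>s1\<close> and \<open>s2\<close>.\<close>
    have "A * h \<le> A * t"
      using hlet assms by simp
    then have s3: "\<bar>s3\<bar> \<le> A * t"
      using s by linarith
    define E where "E = F - k + s1 * G1 + s2 * G2 + s3 * G3"
    have "A * k\<^sup>2 \<le> A * (u * x / 2)\<^sup>2"
      using k0 assms by (intro mult_left_mono power_mono) auto
    then have "\<bar>E\<bar> \<le> A * (u * x / 2)\<^sup>2 + 8 * A\<^sup>2 / l * x\<^sup>2 + 8 * A\<^sup>2 / l * x\<^sup>2 + 8 * A\<^sup>2 / l * x\<^sup>2"
      unfolding E_def using FG(1) G[OF s(2) FG(2)] G[OF s(3) FG(3)] G[OF s3 FG(4)] by linarith
    then have E: "\<bar>E\<bar> \<le> c1 * x\<^sup>2"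
      by (simp add: c1_def power_mult_distrib power_divide algebra_simps)
    have 1: "\<bar>k - \<tau>\<bar> \<le> u * A / 4 * x\<^sup>2"
    proof -
      have "\<tau> * (A * t) \<le> (u * x / 4) * (A * x)"
        using \<tau>b tx assms x0 t by (intro mult_mono) auto
      then show ?thesis
        using k[unfolded \<tau>] by (simp add: power2_eq_square algebra_simps)
    qed
    have "A * h \<le> A * x" "A * h \<le> A" "A * h \<le> A * x\<^sup>2"
      using hlet tx h assms hx2 by auto
    then have s0: "\<bar>s0\<bar> \<le> A * x" "\<bar>s0\<bar> \<le> A" and s5: "\<bar>s5\<bar> \<le> A * x\<^sup>2"
      using s by linarith+
    have 2: "\<bar>s0 * k\<bar> \<le> A * u / 2 * x\<^sup>2"
    proof -
      have "\<bar>s0 * k\<bar> \<le> (A * x) * (u * x / 2)"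
        unfolding abs_mult using s0 k0 assms x0 by (intro mult_mono) auto
      then show ?thesis
        by (simp add: power2_eq_square algebra_simps)
    qed
    have 3: "\<bar>s0 * E\<bar> \<le> A * c1 * x\<^sup>2"
      using mult_mono[OF s0(2) E] assms by (simp add: abs_mult mult.assoc)
    have "(1 + s0) * (F + s1 * G1 + s2 * G2 + s3 * G3) + s5 - \<tau> = (k - \<tau>) + E + s0 * k + s0 * E + s5"
      by (simp add: E_def algebra_simps)
    then have "\<bar>(1 + s0) * (F + s1 * G1 + s2 * G2 + s3 * G3) + s5 - \<tau>\<bar>
        \<le> u * A / 4 * x\<^sup>2 + c1 * x\<^sup>2 + A * u / 2 * x\<^sup>2 + A * c1 * x\<^sup>2 + A * x\<^sup>2"
      using 1 2 3 E s5 by linarith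
    also have "\<dots> = c2 * x\<^sup>2"
      by (simp add: c2_def algebra_simps)
    finally have "\<bar>(1 + s0) * (F + s1 * G1 + s2 * G2 + s3 * G3) + s5 - \<tau>\<bar> / \<tau> \<le> c2 * x\<^sup>2 / (l * x / 4)"
      using \<tau>b x0 assms c by (intro frac_le) auto
    also have "\<dots> = 4 * c2 / l * x"
      using x0 assms by (simp add: field_simps power2_eq_square)
    also have "\<bar>(1 + s0) * (F + s1 * G1 + s2 * G2 + s3 * G3) + s5 - \<tau>\<bar> / \<tau> =
        \<bar>((1 + s0) * (F + s1 * G1 + s2 * G2 + s3 * G3) + s5) / \<tau> - 1\<bar>"
      using \<tau>b by (simp add: abs_div_pos diff_divide_distrib)
    finally show "\<bar>((1 + s0) * (F + s1 * G1 + s2 * G2 + s3 * G3) + s5) / (\<sigma> * t\<^sup>2 / (4 * h)) - 1\<bar> \<le> 4 * c2 / l * (t\<^sup>2 / h)"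
      by (simp only: \<tau> x_def)
  qed
qed

text \<open>The numerator is written as \<open>(1 - E) + T\<close>, so the quotient is
  \<open>1 + T / (1 - E)\<close>. Every term of \<open>T\<close> carries a factor \<open>E\<close>,
  \<open>G\<close> or \<open>s3\<close> of size \<open>h\<close>, so boundedness of
  \<open>s1\<close> and \<open>s2\<close> suffices.\<close>

lemma long_range_bound:
  fixes A :: real
  assumes "0 < A" "0 < h" "h \<le> 1" "0 \<le> E" "E \<le> 1 / 2" "E \<le> h" "\<bar>G\<bar> \<le> A * h"
    "\<bar>s0\<bar> \<le> A * h" "\<bar>s1\<bar> \<le> A" "\<bar>s2\<bar> \<le> A" "\<bar>s3\<bar> \<le> A * h" "\<bar>s5\<bar> \<le> A * h"
  shows "\<bar>(1 + s0) / (1 - E) * (1 + (1 + s1) * E + (1 + s2) * G + s3) + s5 - 1\<bar>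
    \<le> (2 * (1 + A) * ((1 + A) + (1 + A) * A + A + 1) + 2 * A) * h"
proof -
  define c where "c = (1 + A) + (1 + A) * A + A + 1"
  define T where "T = (1 + s1) * E + (1 + s2) * G + s3 + E"
  have "\<bar>(1 + s1) * E\<bar> \<le> (1 + A) * h" "\<bar>(1 + s2) * G\<bar> \<le> (1 + A) * (A * h)"
    unfolding abs_mult using assms by (auto intro!: mult_mono)
  then have "\<bar>T\<bar> \<le> (1 + A) * h + (1 + A) * (A * h) + A * h + h"
    unfolding T_def using assms(4,6,11) by linarith
  then have "\<bar>T\<bar> \<le> c * h"
    by (simp add: c_def algebra_simps)
  moreover have "\<bar>T / (1 - E)\<bar> \<le> \<bar>T\<bar> * 2"
    using assms mult_left_mono[of 1 "(1 - E) * 2" "\<bar>T\<bar>"] by (simp add: abs_divide field_simps)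
  ultimately have T: "\<bar>T / (1 - E)\<bar> \<le> 2 * c * h"
    by linarith
  have "A * h \<le> A"
    using assms by simp
  then have "\<bar>1 + s0\<bar> \<le> 1 + A"
    using assms(8) by linarith
  from mult_mono[OF this T] have 1: "\<bar>(1 + s0) * (T / (1 - E))\<bar> \<le> (1 + A) * (2 * c * h)"
    using assms by (simp add: abs_mult)
  have eq: "(1 + s0) / (1 - E) * (1 + (1 + s1) * E + (1 + s2) * G + s3) + s5 - 1 = (1 + s0) * (T / (1 - E)) + s0 + s5"
  proof -
    have num: "1 + (1 + s1) * E + (1 + s2) * G + s3 = (1 - E) + T"
      by (simp add: T_def)
    have "(1 + s0) / (1 - E) * ((1 - E) + T) = (1 + s0) + (1 + s0) * (T / (1 - E))"
      using assms by (simp add: distrib_left del: diff_add_eq)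
    then show ?thesis
      unfolding num by linarith
  qed
  have "\<bar>(1 + s0) / (1 - E) * (1 + (1 + s1) * E + (1 + s2) * G + s3) + s5 - 1\<bar> \<le> (1 + A) * (2 * c * h) + A * h + A * h"
    unfolding eq by (intro order_trans[OF abs_triangle_ineq] add_mono 1 assms(8,12))
  also have "\<dots> = (2 * (1 + A) * c + 2 * A) * h"
    by (simp add: algebra_simps)
  finally show ?thesis
    unfolding c_def .
qed

section \<open>Semiclassical estimates\<close>

lemma semiclassical_mono:
  assumes "\<And>h. R h \<subseteq> R' h"
  shows "semiclassical R \<le> semiclassical R'"
  unfolding semiclassical_def using assms by (intro inf_mono) auto

lemma eventually_semiclassical_fst:
  assumes "\<forall>\<^sub>F h in at_right 0. P h"
  shows "\<forall>\<^sub>F p in semiclassical R. P (fst p)"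
  using assms unfolding eventually_semiclassical_iff eventually_at_right_field by auto

lemma eventually_semiclassical_mem: "\<forall>\<^sub>F p in semiclassical R. snd p \<in> R (fst p)"
  unfolding eventually_semiclassical_iff by (auto intro: exI[of _ 1])

lemma tendsto_fst_semiclassical: "(fst \<longlongrightarrow> 0) (semiclassical R)"
proof -
  have "filterlim fst (at_right 0) (semiclassical R)"
    unfolding filterlim_def le_filter_def eventually_filtermap
    by (auto intro: eventually_semiclassical_fst)
  then show ?thesis
    by (rule filterlim_mono) (simp_all add: at_within_def)
qed

text \<open>The lower bound for \<open>e\<close> yields
  \<open>exp (- e / h) \<le> h powr (\<kappa> - 1/2)\<close>, and the prefactor
  \<open>sqrt h\<close> supplies the missing half power; 26/5 is 52/10.\<close>

lemma coupling_le:
  fixes h e \<kappa> C0 :: real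
  assumes h: "0 < h" "h < 1" and "52 / 10 < \<kappa>" "0 < C0"
    and e: "(\<kappa> - 1/2) * h * ln (1 / h) + C0 * h \<le> e"
  shows "sqrt h * exp (- e / h) \<le> h powr (26/5)"
proof -
  have "(\<kappa> - 1/2) * ln (1 / h) + C0 \<le> e / h"
    using e h by (simp add: field_simps)
  then have "- e / h \<le> (\<kappa> - 1/2) * ln h"
    using h assms(4) by (simp add: ln_div)
  then have "exp (- e / h) \<le> h powr (\<kappa> - 1/2)"
    using h by (simp add: powr_def)
  then have "sqrt h * exp (- e / h) \<le> h powr (1/2) * h powr (\<kappa> - 1/2)"
    using h by (intro mult_mono) (auto simp: powr_half_sqrt)
  also have "\<dots> = h powr \<kappa>"
    by (simp flip: powr_add)
  also have "\<dots> \<le> h powr (26/5)"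
    using h assms(3) by (intro powr_mono') auto
  finally show ?thesis .
qed

text \<open>Five times 4/7 is 20/7, which is below 3; this gives \<open>h ^ 3 \<le> t ^ 5\<close>.
  The bound for \<open>M * (t^2 / h)\<close> is what later makes the correlation small through the
  choice of \<open>M\<close>.\<close>

lemma close_range_scales:
  fixes h t M :: real
  assumes h: "0 < h" "h \<le> 1" and M: "1 \<le> M" and t: "M * h powr (4/7) \<le> t" "M * t \<le> h powr (1/2)"
  shows "0 < t" "h ^ 3 \<le> t ^ 5" "M * (t\<^sup>2 / h) \<le> 1" "t \<le> sqrt h"
proof -
  have hp: "0 < h powr (4/7)"
    using h by simp
  have le: "h powr (4/7) \<le> t"
    using t(1) mult_right_mono[OF M, of "h powr (4/7)"] hp by linarith
  then show "0 < t"
    using hp by linarith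
  then have "t \<le> M * t"
    using M by simp
  then show "t \<le> sqrt h"
    using t(2) h by (simp add: powr_half_sqrt)
  have "h ^ 3 = h powr 3"
    using h by (simp add: powr_numeral)
  also have "\<dots> \<le> h powr (20/7)"
    using h by (intro powr_mono') auto
  also have "\<dots> = (h powr (4/7)) ^ 5"
    using h by (simp add: powr_power)
  also have "\<dots> \<le> t ^ 5"
    using le by (intro power_mono) auto
  finally show "h ^ 3 \<le> t ^ 5" .
  have "(M * t)\<^sup>2 \<le> (sqrt h)\<^sup>2"
    using t(2) h M \<open>0 < t\<close> by (intro power_mono) (auto simp: powr_half_sqrt)
  then have "M * (M * t\<^sup>2) \<le> h"
    using h by (simp add: power2_eq_square algebra_simps)
  moreover have "M * t\<^sup>2 \<le> M * (M * t\<^sup>2)"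
    using M mult_right_mono[OF M, of "t\<^sup>2"] by simp
  ultimately show "M * (t\<^sup>2 / h) \<le> 1"
    using h by (simp add: field_simps)
qed

text \<open>\<open>\<sigma>h\<close> is known up to O(h) through the weight at the midpoint, which
  convexity keeps in \<open>\<Omega>\<close>. Off \<open>D_set\<close> one has
  \<open>c * h \<le> c * h powr (3/5) \<le> cmod (z - w)\<close>, so this error is O(|z - w|), like
  the variation of \<open>S\<close> between midpoint and end points. For equal arguments the
  midpoint is the point itself, which links \<open>d h z\<close> with
  \<open>\<sigma>h h z z\<close>.\<close>

lemma two_point_weight_bounds:
  fixes \<sigma>h :: "real \<Rightarrow> complex \<Rightarrow> complex \<Rightarrow> real" and d :: "real \<Rightarrow> complex \<Rightarrow> real"
    and s :: "complex \<Rightarrow> complex" and S :: "complex \<Rightarrow> real"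
  assumes conv: "convex \<Omega>" and C: "0 < C" and c: "0 < c" and l: "0 < l"
    and S: "\<And>z. z \<in> \<Omega> \<Longrightarrow> s z = of_real (S z)" "\<And>z. z \<in> \<Omega> \<Longrightarrow> l \<le> S z \<and> S z \<le> u"
    and lip: "\<And>z w. z \<in> \<Omega> \<Longrightarrow> w \<in> \<Omega> \<Longrightarrow> \<bar>S z - S w\<bar> \<le> L * cmod (z - w)"
    and d: "(\<lambda>(h, z). of_real (d h z) - s z / of_real (2 * pi * h)) \<in> O[semiclassical (\<lambda>h. \<Omega>)](\<lambda>_. 1)"
    and \<sigma>: "(\<lambda>(h, z, w). of_real (\<sigma>h h z w) - s ((z + w) / 2))
      \<in> O[semiclassical (\<lambda>h. near_diagonal \<Omega> C)](\<lambda>(h, z, w). of_real h)"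
  shows "\<exists>A>0. \<forall>\<^sub>F (h, z, w) in semiclassical (\<lambda>h. near_diagonal \<Omega> C - D_set \<Omega> c h).
    h \<le> 1 \<and> h \<le> A * cmod (z - w) \<and>
    l / 2 \<le> \<sigma>h h z z \<and> l / 2 \<le> \<sigma>h h w w \<and> l / 2 \<le> \<sigma>h h z w \<and> \<sigma>h h z w \<le> A \<and>
    \<bar>(\<sigma>h h z w)\<^sup>2 - \<sigma>h h z z * \<sigma>h h w w\<bar> \<le> A * cmod (z - w) \<and>
    \<bar>d h z - \<sigma>h h z z / (2 * pi * h)\<bar> \<le> A \<and> \<bar>d h w - \<sigma>h h w w / (2 * pi * h)\<bar> \<le> A"
proof -
  obtain A1 h1 where 1: "0 < A1" "0 < h1"
    "\<And>h z. 0 < h \<Longrightarrow> h < h1 \<Longrightarrow> z \<in> \<Omega> \<Longrightarrow> cmod (of_real (d h z) - s z / of_real (2 * pi * h)) \<le> A1"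
    using d unfolding bigo_semiclassical_iff by auto
  obtain A2 h2 where 2: "0 < A2" "0 < h2"
    "\<And>h z w. 0 < h \<Longrightarrow> h < h2 \<Longrightarrow> (z, w) \<in> near_diagonal \<Omega> C \<Longrightarrow>
      cmod (of_real (\<sigma>h h z w) - s ((z + w) / 2)) \<le> A2 * h"
    using \<sigma> unfolding bigo_semiclassical_iff by auto
  have dS: "\<bar>d h z - S z / (2 * pi * h)\<bar> \<le> A1" if "0 < h" "h < h1" "z \<in> \<Omega>" for h z
  proof -
    have "of_real (d h z) - s z / of_real (2 * pi * h) = complex_of_real (d h z - S z / (2 * pi * h))"
      using S(1)[OF that(3)] by simp
    then show ?thesis
      using 1(3)[OF that] by (simp only: norm_of_real)
  qed
  have mid: "(z + w) / 2 \<in> \<Omega>" if "z \<in> \<Omega>" "w \<in> \<Omega>" for z w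
    using convexD[OF conv that, of "1/2" "1/2"] by (simp add: scaleR_conv_of_real add_divide_distrib)
  have \<sigma>S: "\<bar>\<sigma>h h z w - S ((z + w) / 2)\<bar> \<le> A2 * h"
    if "0 < h" "h < h2" "(z, w) \<in> near_diagonal \<Omega> C" for h z w
  proof -
    have "of_real (\<sigma>h h z w) - s ((z + w) / 2) = complex_of_real (\<sigma>h h z w - S ((z + w) / 2))"
      using S(1)[OF mid] that(3) by (simp add: near_diagonal_def)
    then show ?thesis
      using 2(3)[OF that] by (simp only: norm_of_real)
  qed
  \<comment> \<open>\<open>2 * m * t\<close> will bound the difference of two weights, each within
    \<open>A2 * h \<le> A2 / c * t\<close> of a value of \<open>S\<close>. No sign of
    \<open>L\<close> or \<open>u\<close> is known, hence the absolute values.\<close>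
  define m where "m = A2 / c + \<bar>L\<bar>"
  define U where "U = \<bar>u\<bar> + A2"
  define A where "A = 1 / c + U + 2 * U * (2 * m) + (A1 + A2)"
  have m: "0 < m" "0 < U"
    using divide_pos_pos[OF 2(1) c] 2(1) unfolding m_def U_def by linarith+
  have pos: "0 < 1 / c" "0 < 2 * U * (2 * m)"
    using m c by auto
  have A: "0 < A" "1 / c \<le> A" "U \<le> A" "2 * U * (2 * m) \<le> A" "A1 + A2 \<le> A"
    using pos m 1(1) 2(1) unfolding A_def by linarith+
  \<comment> \<open>The last entry gives \<open>A2 * h < l / 2\<close>, so the lower bound
    \<open>l\<close> of \<open>S\<close> leaves \<open>l / 2\<close> for
    \<open>\<sigma>h\<close>.\<close>
  define h0 where "h0 = Min {1, h1, h2, l / (2 * A2)}"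
  have h0: "0 < h0"
    using 1 2 l by (simp add: h0_def)
  show ?thesis
    unfolding eventually_semiclassical_iff
  proof (rule exI[of _ A], rule conjI[OF A(1)], rule exI[of _ h0], rule conjI[OF h0],
      intro allI impI, unfold split_paired_all prod.case, elim conjE DiffE)
    fix h :: real and z w
    assume h: "0 < h" "h < h0" and zw: "(z, w) \<in> near_diagonal \<Omega> C" "(z, w) \<notin> D_set \<Omega> c h"
    define t where "t = cmod (z - w)"
    have h': "h < 1" "h < h1" "h < h2" "A2 * h < l / 2"
      using h(2) 2(1) by (auto simp: h0_def field_simps)
    have z: "z \<in> \<Omega>" "w \<in> \<Omega>" "(z, z) \<in> near_diagonal \<Omega> C" "(w, w) \<in> near_diagonal \<Omega> C"
      using zw(1) C by (auto simp: near_diagonal_def)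
    have "h powr 1 \<le> h powr (3/5)"
      using h h' by (intro powr_mono') auto
    then have "c * h \<le> c * h powr (3/5)"
      using c h by simp
    also have "\<dots> \<le> t"
      using zw(2) z by (auto simp: D_set_def t_def)
    finally have ct: "c * h \<le> t" .
    then have hct: "h \<le> 1 / c * t"
      using c by (simp add: field_simps)
    have t0: "0 \<le> t"
      by (simp add: t_def)
    have zz: "\<bar>\<sigma>h h z z - S z\<bar> \<le> A2 * h" and ww: "\<bar>\<sigma>h h w w - S w\<bar> \<le> A2 * h"
      using \<sigma>S[OF h(1) h'(3) z(3)] \<sigma>S[OF h(1) h'(3) z(4)] by simp_all
    note mm = \<sigma>S[OF h(1) h'(3) zw(1)] mid[OF z(1,2)]
    have A2h: "A2 * h \<le> A2"
      using 2(1) h' by simp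
    have lower: "l / 2 \<le> \<sigma>h h z z" "l / 2 \<le> \<sigma>h h w w" "l / 2 \<le> \<sigma>h h z w"
      using zz ww mm(1) h'(4) S(2)[OF z(1)] S(2)[OF z(2)] S(2)[OF mm(2)] by linarith+
    have upper: "\<sigma>h h z z \<le> U" "\<sigma>h h w w \<le> U" "\<sigma>h h z w \<le> U"
      unfolding U_def using zz ww mm(1) A2h S(2)[OF z(1)] S(2)[OF z(2)] S(2)[OF mm(2)] by linarith+
    have lip': "\<bar>S ((z + w) / 2) - S x\<bar> \<le> \<bar>L\<bar> * t" if "x = z \<or> x = w" for x
    proof -
      have "cmod ((z + w) / 2 - x) = t / 2"
      proof -
        have e: "(z + w) / 2 - z = - ((z - w) / 2)" "(z + w) / 2 - w = (z - w) / 2"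
          by (simp_all add: field_simps)
        have "cmod ((z + w) / 2 - z) = t / 2" "cmod ((z + w) / 2 - w) = t / 2"
          unfolding e norm_minus_cancel t_def by (simp_all add: norm_divide)
        then show ?thesis
          using that by auto
      qed
      moreover have "x \<in> \<Omega>"
        using that z by auto
      ultimately have "\<bar>S ((z + w) / 2) - S x\<bar> \<le> L * (t / 2)"
        using lip[OF mm(2)] by metis
      also have "\<dots> \<le> \<bar>L\<bar> * t"
        using t0 by (intro mult_mono) auto
      finally show ?thesis .
    qed
    have "A2 * h \<le> A2 / c * t"
      using mult_left_mono[OF hct, of A2] 2(1) by simp
    then have "\<bar>\<sigma>h h z w - \<sigma>h h z z\<bar> \<le> 2 * (A2 / c * t) + \<bar>L\<bar> * t" "\<bar>\<sigma>h h z w - \<sigma>h h w w\<bar> \<le> 2 * (A2 / c * t) + \<bar>L\<bar> * t"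
      using zz ww mm(1) lip'[OF disjI1[OF refl]] lip'[OF disjI2[OF refl]] by linarith+
    moreover have "2 * (A2 / c * t) + \<bar>L\<bar> * t \<le> 2 * m * t"
      using t0 by (simp add: m_def algebra_simps)
    ultimately have close: "\<bar>\<sigma>h h z w - \<sigma>h h z z\<bar> \<le> 2 * m * t" "\<bar>\<sigma>h h z w - \<sigma>h h w w\<bar> \<le> 2 * m * t"
      by linarith+
    have eq: "(\<sigma>h h z w)\<^sup>2 - \<sigma>h h z z * \<sigma>h h w w =
        \<sigma>h h z w * (\<sigma>h h z w - \<sigma>h h z z) + \<sigma>h h z z * (\<sigma>h h z w - \<sigma>h h w w)"
      by (simp add: power2_eq_square algebra_simps)
    have prod: "\<bar>x * y\<bar> \<le> U * (2 * m * t)" if "l / 2 \<le> x" "x \<le> U" "\<bar>y\<bar> \<le> 2 * m * t" for x y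
      unfolding abs_mult using that l m by (intro mult_mono) auto
    have "\<bar>(\<sigma>h h z w)\<^sup>2 - \<sigma>h h z z * \<sigma>h h w w\<bar> \<le> U * (2 * m * t) + U * (2 * m * t)"
      unfolding eq by (intro order_trans[OF abs_triangle_ineq] add_mono prod lower upper close)
    also have "\<dots> = 2 * U * (2 * m) * t"
      by simp
    also have "\<dots> \<le> A * t"
      using A t0 by (intro mult_right_mono) auto
    finally have sq: "\<bar>(\<sigma>h h z w)\<^sup>2 - \<sigma>h h z z * \<sigma>h h w w\<bar> \<le> A * t" .
    have dd: "\<bar>d h x - \<sigma>h h x x / (2 * pi * h)\<bar> \<le> A" if "x \<in> \<Omega>" "\<bar>\<sigma>h h x x - S x\<bar> \<le> A2 * h" for x
    proof -
      have "\<bar>S x / (2 * pi * h) - \<sigma>h h x x / (2 * pi * h)\<bar> = \<bar>\<sigma>h h x x - S x\<bar> / (2 * pi * h)"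
        unfolding diff_divide_distrib[symmetric] abs_divide using h by (simp add: abs_minus_commute abs_mult)
      also have "\<dots> \<le> A2 * h / (2 * pi * h)"
        using that h by (intro divide_right_mono) auto
      also have "\<dots> \<le> A2"
        using h 2(1) pi_gt3 by (simp add: field_simps)
      finally show ?thesis
        using dS[OF h(1) h'(2) that(1)] A(5) by linarith
    qed
    have "1 / c * t \<le> A * t"
      using A t0 by (intro mult_right_mono) auto
    then have "h \<le> A * t"
      using hct by linarith
    moreover have "\<sigma>h h z w \<le> A"
      using upper A(3) by linarith
    ultimately show "h \<le> 1 \<and> h \<le> A * cmod (z - w) \<and>
        l / 2 \<le> \<sigma>h h z z \<and> l / 2 \<le> \<sigma>h h w w \<and> l / 2 \<le> \<sigma>h h z w \<and> \<sigma>h h z w \<le> A \<and>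
        \<bar>(\<sigma>h h z w)\<^sup>2 - \<sigma>h h z z * \<sigma>h h w w\<bar> \<le> A * cmod (z - w) \<and>
        \<bar>d h z - \<sigma>h h z z / (2 * pi * h)\<bar> \<le> A \<and> \<bar>d h w - \<sigma>h h w w / (2 * pi * h)\<bar> \<le> A"
      using h'(1) lower sq dd[OF z(1) zz] dd[OF z(2) ww] unfolding t_def by simp
  qed
qed

section \<open>The correlation function\<close>

theorem theorem8:
  fixes g :: "real \<Rightarrow> complex" and a b :: real and \<Omega> :: "complex set"
    and C C0 C1 C' c D0 \<kappa> :: real
    and \<epsilon>0 \<delta> :: "real \<Rightarrow> real"
    and d :: "real \<Rightarrow> complex \<Rightarrow> real"
    and \<nu> :: "real \<Rightarrow> (complex \<times> complex) measure"
    and D K \<sigma>h :: "real \<Rightarrow> complex \<Rightarrow> complex \<Rightarrow> real"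
  defines "U \<equiv> semiclassical (\<lambda>h. near_diagonal \<Omega> C)"
    and "V \<equiv> semiclassical (\<lambda>h. near_diagonal \<Omega> C - D_set \<Omega> c h)"
  assumes "admissible_potential g a b"
    and "admissible_domain g \<Omega>"
    and "C1 > 0" and "C' > 0" and "C0 > 0" and "\<kappa> > 52 / 10" and "C > 1" and "c > 0" and "D0 > 0"
    \<comment> \<open>coupling constant\<close>
    and "\<And>h. \<delta> h = sqrt h * exp (- \<epsilon>0 h / h)"
    and "\<forall>\<^sub>F h in at_right 0. (\<kappa> - 1/2) * h * ln (1 / h) + C0 * h \<le> \<epsilon>0 h
           \<and> \<epsilon>0 h < (INF z\<in>closure \<Omega>. action g a b z) / C0"
    \<comment> \<open>one-point density\<close>
    and "\<forall>\<^sub>F h in at_right 0. one_point_density g C1 C' h (\<delta> h) \<Omega> (d h)"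
    and "(\<lambda>(h, z). of_real (d h z) - sigma_weight g a b z / of_real (2 * pi * h))
           \<in> O[semiclassical (\<lambda>h. \<Omega>)](\<lambda>_. 1)"
    \<comment> \<open>two-point density\<close>
    and "\<forall>\<^sub>F h in at_right 0. two_point_measure g C1 C' h (\<delta> h) \<Omega> (\<nu> h)"
    and "\<forall>\<^sub>F h in at_right 0.
           lebesgue_density_on (near_diagonal \<Omega> C - D_set \<Omega> c h) (\<nu> h) (\<lambda>(z, w). D h z w)
           \<and> smooth_on (near_diagonal \<Omega> C - D_set \<Omega> c h) (\<lambda>(z, w). D h z w)"
    and "\<forall>\<^sub>F h in at_right 0. smooth_on (near_diagonal \<Omega> C) (\<lambda>(z, w). \<sigma>h h z w)
           \<and> smooth_on (near_diagonal \<Omega> C - D_set \<Omega> c h) (\<lambda>(z, w). K h z w)"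
    and "(\<lambda>(h, z, w). of_real (\<sigma>h h z w) - sigma_weight g a b ((z + w) / 2))
           \<in> O[U](\<lambda>(h, z, w). of_real h)"
    and "\<exists>r1 r2. r1 \<in> O[V](\<lambda>(h, z, w). cmod (z - w)) \<and> r2 \<in> bigo_h_infinity V \<and>
           (\<forall>\<^sub>F (h, z, w) in V. K h z w =
              \<sigma>h h z w * (cmod (z - w))\<^sup>2 / (4 * h) * (1 + r1 (h, z, w) + r2 (h, z, w)))"
    and "\<exists>r1 r2 r3 r4 r5 r6.
           r1 \<in> O[V](\<lambda>(h, z, w). cmod (z - w)) \<and>
           r2 \<in> O[V](\<lambda>(h, z, w). cmod (z - w)) \<and>
           r3 \<in> bigo_h_infinity V \<and>
           r4 \<in> O[V](\<lambda>(h, z, w). \<delta> h * h powr (- 32/10)) \<and>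
           r5 \<in> O[V](\<lambda>(h, z, w). \<delta> h * h powr (- 8/5)) \<and>
           r6 \<in> O[V](\<lambda>(h, z, w). exp (- D0 / h\<^sup>2)) \<and>
           (\<forall>\<^sub>F (h, z, w) in V.
              let k = K h z w; p = (h, z, w);
                  \<Lambda> = \<sigma>h h z z * \<sigma>h h w w
                      + (\<sigma>h h z w)\<^sup>2 * (1 + r1 p) * exp (- 2 * k)
                      + (\<sigma>h h z w)\<^sup>2 * (1 + r2 p) / (exp k * sinh k) * (2 * k\<^sup>2 * coth k - 4 * k)
                      + r3 p + r4 p
              in D h z w = \<Lambda> / ((2 * pi * h)\<^sup>2 * (1 - exp (- 2 * k))) * (1 + r5 p) + r6 p)"
  shows "\<exists>C2\<ge>C.
    let R = (\<lambda>h. near_diagonal \<Omega> C2 - D_set \<Omega> c h);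
        W = semiclassical R;
        corr = two_point_correlation d D
    in
    \<comment> \<open>main formula\<close>
    (\<exists>D'>0. \<exists>r0 r1 r2 r3 r4 r5.
       r0 \<in> O[W](\<lambda>(h, z, w). h) \<and>
       r1 \<in> O[W](\<lambda>(h, z, w). cmod (z - w)) \<and>
       r2 \<in> O[W](\<lambda>(h, z, w). cmod (z - w)) \<and>
       r3 \<in> bigo_h_infinity W \<and>
       r4 \<in> O[W](\<lambda>(h, z, w). \<delta> h * h powr (- 32/10)) \<and>
       r5 \<in> O[W](\<lambda>(h, z, w). exp (- D' / h\<^sup>2)) \<and>
       (\<forall>\<^sub>F (h, z, w) in W.
          let k = K h z w; p = (h, z, w)
          in corr h z w =
               (1 + r0 p) / (1 - exp (- 2 * k)) *
                 (1 + (1 + r1 p) * exp (- 2 * k)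
                    + (1 + r2 p) / (exp k * sinh k) * (2 * k\<^sup>2 * coth k - 4 * k)
                    + r3 p + r4 p)
               + r5 p)) \<and>
    \<comment> \<open>(i)\<close>
    (let W1 = (\<lambda>M. semiclassical (\<lambda>h. {(z, w) \<in> R h.
           M * h powr (4/7) \<le> cmod (z - w) \<and> M * cmod (z - w) \<le> h powr (1/2)}))
     in (\<exists>M>0. \<exists>r. r \<in> O[W1 M](\<lambda>(h, z, w). (cmod (z - w))\<^sup>2 / h + \<delta> h * h powr (- 8/5)) \<and>
           (\<forall>\<^sub>F (h, z, w) in W1 M.
              corr h z w = \<sigma>h h z w * (cmod (z - w))\<^sup>2 / (4 * h) * (1 + r (h, z, w)))) \<and>
        (\<forall>\<eta>>0. \<exists>M>0. \<forall>\<^sub>F (h, z, w) in W1 M. \<bar>corr h z w\<bar> \<le> \<eta>)) \<and>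
    \<comment> \<open>(ii)\<close>
    (let W2 = (\<lambda>M. semiclassical (\<lambda>h. {(z, w) \<in> R h.
           M * sqrt (h * ln (1 / h)) \<le> cmod (z - w)}))
     in \<exists>M>0. (\<lambda>(h, z, w). corr h z w - 1) \<in> O[W2 M](\<lambda>(h, z, w). h))"
proof -
  note C0 = assms(7) and \<kappa> = assms(8) and C = assms(9) and c = assms(10) and D0 = assms(11)

  \<comment> \<open>Sizes of the weights, the densities and the coupling constant\<close>
  define h :: "real \<times> complex \<times> complex \<Rightarrow> real" where "h = fst"
  define t :: "real \<times> complex \<times> complex \<Rightarrow> real" where "t = (\<lambda>(h, z, w). cmod (z - w))"
  define \<Delta> :: "real \<times> complex \<times> complex \<Rightarrow> real" where "\<Delta> = (\<lambda>(h, z, w). \<delta> h)"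
  define k \<sigma> \<sigma>z \<sigma>w dz dw d2
    where "k = (\<lambda>(h, z, w). K h z w)" and "\<sigma> = (\<lambda>(h, z, w). \<sigma>h h z w)"
      and "\<sigma>z = (\<lambda>(h, z, w :: complex). \<sigma>h h z z)" and "\<sigma>w = (\<lambda>(h, z :: complex, w). \<sigma>h h w w)"
      and "dz = (\<lambda>(h, z, w :: complex). d h z)" and "dw = (\<lambda>(h, z :: complex, w). d h w)"
      and "d2 = (\<lambda>(h, z, w). D h z w)"
  note defs = h_def t_def \<Delta>_def k_def \<sigma>_def \<sigma>z_def \<sigma>w_def dz_def dw_def d2_def
  obtain S l u L where S: "0 < l" "\<And>z. z \<in> \<Omega> \<Longrightarrow> sigma_weight g a b z = of_real (S z)"
    "\<And>z. z \<in> \<Omega> \<Longrightarrow> l \<le> S z \<and> S z \<le> u"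
    "\<And>z w. z \<in> \<Omega> \<Longrightarrow> w \<in> \<Omega> \<Longrightarrow> \<bar>S z - S w\<bar> \<le> L * cmod (z - w)"
    using sigma_weight_regular[OF assms(3,4)] by metis
  define l2 where "l2 = l / 2"
  have l2: "0 < l2"
    using S(1) by (simp add: l2_def)
  have "convex \<Omega>" "0 < C"
    using assms(4) C by (auto simp: admissible_domain_def)
  from two_point_weight_bounds[OF this c S assms(15) assms(19)[unfolded U_def]]
  obtain A0 where A0: "0 < A0" and bounds: "\<forall>\<^sub>F p in V. h p \<le> 1 \<and> h p \<le> A0 * t p \<and>
      l2 \<le> \<sigma>z p \<and> l2 \<le> \<sigma>w p \<and> l2 \<le> \<sigma> p \<and> \<sigma> p \<le> A0 \<and>
      \<bar>(\<sigma> p)\<^sup>2 - \<sigma>z p * \<sigma>w p\<bar> \<le> A0 * t p \<and>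
      \<bar>dz p - \<sigma>z p / (2 * pi * h p)\<bar> \<le> A0 \<and> \<bar>dw p - \<sigma>w p / (2 * pi * h p)\<bar> \<le> A0"
    unfolding V_def[symmetric] l2_def[symmetric] defs by (auto simp: case_prod_unfold)
  have hV: "\<forall>\<^sub>F p in V. 0 < h p" "(h \<longlongrightarrow> 0) V"
    unfolding V_def h_def using eventually_semiclassical_fst[OF eventually_at_right_less[of "0::real"]]
    by (simp_all add: tendsto_fst_semiclassical)
  have bigo_h: "f \<in> O[V](h)" if "\<forall>\<^sub>F x in at_right 0. \<bar>e x\<bar> \<le> x" "f \<in> O[V](\<lambda>p. e (h p))" for e f
  proof (rule landau_o.big_trans[OF that(2)], rule bigoI[where c = 1])
    show "\<forall>\<^sub>F p in V. norm (e (h p)) \<le> 1 * norm (h p)"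
      using eventually_semiclassical_fst[OF that(1), of "\<lambda>h. near_diagonal \<Omega> C - D_set \<Omega> c h"] hV(1)
      unfolding V_def[symmetric] h_def by eventually_elim simp
  qed
  have small: "\<forall>\<^sub>F x in at_right 0. 0 < \<delta> x \<and> \<delta> x \<le> x powr (26/5)"
    using assms(13) eventually_at_right_less[of "0::real"] eventually_at_right_real[of 0 1, simplified]
  proof eventually_elim
    case (elim x)
    then show ?case
      using coupling_le[of x \<kappa> C0 "\<epsilon>0 x"] \<kappa> C0 by (auto simp: assms(12))
  qed
  \<comment> \<open>The threshold \<open>- 42/10\<close> is 1 - 26/5; the exponents
    \<open>- 32/10\<close> and \<open>- 8/5\<close> both lie above it.\<close>
  have small': "\<forall>\<^sub>F x in at_right 0. \<bar>\<delta> x * x powr e\<bar> \<le> x" if "- 42/10 \<le> e" for e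
    using small eventually_at_right_less[of "0::real"] eventually_at_right_real[of 0 1, simplified]
  proof eventually_elim
    case (elim x)
    then have "\<delta> x * x powr e \<le> x powr (26/5) * x powr e"
      by (intro mult_right_mono) auto
    also have "\<dots> = x powr (26/5 + e)"
      by (simp flip: powr_add)
    also have "\<dots> \<le> x powr 1"
      using elim that by (intro powr_mono') auto
    finally show ?case
      using elim by simp
  qed
  have exp_small: "\<forall>\<^sub>F x in at_right 0. \<bar>exp (- D0 / x\<^sup>2)\<bar> \<le> x"
    using D0 by real_asymp

  \<comment> \<open>The given expansions of K and of the two-point density\<close>
  obtain q1 q2 where q: "q1 \<in> O[V](t)" "q2 \<in> bigo_h_infinity V"
    "\<forall>\<^sub>F p in V. k p = \<sigma> p * (t p)\<^sup>2 / (4 * h p) * (1 + q1 p + q2 p)"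
    using assms(20) unfolding defs by (auto simp: case_prod_unfold)
  obtain r1 r2 r3 r4 r5 r6 where r: "r1 \<in> O[V](t)" "r2 \<in> O[V](t)" "r3 \<in> bigo_h_infinity V"
    "r4 \<in> O[V](\<lambda>p. \<Delta> p * h p powr (- 32/10))" "r5 \<in> O[V](\<lambda>p. \<Delta> p * h p powr (- 8/5))"
    "r6 \<in> O[V](\<lambda>p. exp (- D0 / (h p)\<^sup>2))"
    and d2: "\<forall>\<^sub>F p in V. d2 p =
      (\<sigma>z p * \<sigma>w p + (\<sigma> p)\<^sup>2 * (1 + r1 p) * exp (- 2 * k p)
         + (\<sigma> p)\<^sup>2 * (1 + r2 p) / (exp (k p) * sinh (k p)) * (2 * (k p)\<^sup>2 * coth (k p) - 4 * k p) + r3 p + r4 p)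
       / ((2 * pi * h p)\<^sup>2 * (1 - exp (- 2 * k p))) * (1 + r5 p) + r6 p"
    using assms(21) unfolding defs Let_def by (auto simp: case_prod_unfold)
  have \<Delta>: "\<Delta> = (\<lambda>p. \<delta> (h p))"
    by (auto simp: \<Delta>_def h_def)
  have "r5 \<in> O[V](h)" 
    using r(5) unfolding \<Delta> by (rule bigo_h[rotated]) (rule small', simp)

  \<comment> \<open>Comparability of K and |z - w|^2 / h\<close>
  obtain B1 where B1: "0 < B1" "\<forall>\<^sub>F p in V. norm (q1 p) \<le> B1 * norm (t p)"
    using q(1) by (elim landau_o.bigE)
  have "q2 \<in> O[V](h)"
    using q(2) unfolding bigo_h_infinity_def h_def by (auto dest: spec[of _ 1])
  then obtain B2 where B2: "0 < B2" "\<forall>\<^sub>F p in V. norm (q2 p) \<le> B2 * norm (h p)"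
    by (elim landau_o.bigE)
  \<comment> \<open>\<open>q2\<close> is estimated as O(h), and \<open>h p \<le> A0 * t p\<close>
    turns this into O(t).\<close>
  define B where "B = B1 + B2 * A0"
  have B: "0 < B"
    using A0 B1 B2 by (simp add: B_def add_pos_pos)
  \<comment> \<open>For \<open>t p \<le> 1 / C2\<close> the relative error \<open>B * t p\<close> is
    at most 1/2, so \<open>k p\<close> lies between half and three halves of its leading
    term.\<close>
  define C2 where "C2 = max C (2 * B)"
  have C2: "C \<le> C2" "2 * B \<le> C2" "1 < C2"
    using C by (auto simp: C2_def)
  define R where "R h = near_diagonal \<Omega> C2 - D_set \<Omega> c h" for h
  define W where "W = semiclassical R"
  have "1 / C2 \<le> 1 / C"
    using C C2 by (simp add: frac_le)
  then have WV: "W \<le> V"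
    unfolding W_def V_def R_def by (intro semiclassical_mono) (auto simp: near_diagonal_def)
  note bigo_W = landau_o.big.filter_mono[OF WV] and ev_W = filter_leD[OF WV]
  have hW: "\<forall>\<^sub>F p in W. 0 < h p" "(h \<longlongrightarrow> 0) W"
    using ev_W hV tendsto_mono[OF WV] by auto
  have tW: "\<forall>\<^sub>F p in W. 0 \<le> t p \<and> B * t p \<le> 1 / 2 \<and> t p \<le> 1"
    using eventually_semiclassical_mem[of R] unfolding W_def[symmetric]
  proof eventually_elim
    case (elim p)
    then have "0 \<le> t p" "t p \<le> 1 / C2"
      by (cases p; auto simp: R_def near_diagonal_def t_def)+
    moreover have "B * (1 / C2) \<le> 1 / 2" "1 / C2 \<le> 1"
      using C2 by (simp_all add: field_simps)
    moreover have "B * t p \<le> B * (1 / C2)"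
      using \<open>t p \<le> 1 / C2\<close> B by (intro mult_left_mono) auto
    ultimately show ?case
      by linarith
  qed
  have kW: "\<forall>\<^sub>F p in W. \<bar>k p - \<sigma> p * (t p)\<^sup>2 / (4 * h p)\<bar> \<le> \<sigma> p * (t p)\<^sup>2 / (4 * h p) * (B * t p)"
    using ev_W[OF bounds] ev_W[OF B1(2)] ev_W[OF B2(2)] ev_W[OF q(3)] hW(1) tW
  proof eventually_elim
    case (elim p)
    have "\<bar>q1 p\<bar> \<le> B1 * t p" "\<bar>q2 p\<bar> \<le> B2 * h p"
      using elim(2,3,5,6) by simp_all
    moreover have "B2 * h p \<le> B2 * (A0 * t p)"
      using elim(1) B2(1) by (intro mult_left_mono) auto
    moreover have "B * t p = B1 * t p + B2 * (A0 * t p)"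
      by (simp add: B_def distrib_right)
    ultimately have "\<bar>q1 p + q2 p\<bar> \<le> B * t p"
      by linarith
    moreover have "0 \<le> \<sigma> p * (t p)\<^sup>2 / (4 * h p)"
      using elim l2 by simp
    ultimately have "\<sigma> p * (t p)\<^sup>2 / (4 * h p) * \<bar>q1 p + q2 p\<bar> \<le> \<sigma> p * (t p)\<^sup>2 / (4 * h p) * (B * t p)"
      by (rule mult_left_mono)
    moreover have "\<bar>k p - \<sigma> p * (t p)\<^sup>2 / (4 * h p)\<bar> = \<sigma> p * (t p)\<^sup>2 / (4 * h p) * \<bar>q1 p + q2 p\<bar>"
    proof -
      have "k p - \<sigma> p * (t p)\<^sup>2 / (4 * h p) = \<sigma> p * (t p)\<^sup>2 / (4 * h p) * (q1 p + q2 p)"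
        unfolding elim(4) by (simp only: distrib_left mult_1_right add.assoc add_diff_cancel_left')
      then show ?thesis
        using \<open>0 \<le> \<sigma> p * (t p)\<^sup>2 / (4 * h p)\<close> by (simp only: abs_mult abs_of_nonneg)
    qed
    ultimately show ?case
      by simp
  qed

  \<comment> \<open>The main formula\<close>
  have "\<exists>s0 s1 s2 s3 s4 s5. s0 \<in> O[W](h) \<and> s1 \<in> O[W](t) \<and> s2 \<in> O[W](t) \<and>
     s3 \<in> O[W](r3) \<and> s4 \<in> O[W](r4) \<and> s5 \<in> O[W](r6) \<and>
     (\<forall>\<^sub>F p in W. d2 p / (dw p * dz p) =
        (1 + s0 p) / (1 - exp (- 2 * k p)) *
          (1 + (1 + s1 p) * exp (- 2 * k p)
             + (1 + s2 p) / (exp (k p) * sinh (k p)) * (2 * (k p)\<^sup>2 * coth (k p) - 4 * k p)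
             + s3 p + s4 p)
        + s5 p)"
  proof (rule normalised_two_point_expansion[OF hW(2,1) l2])
    show "\<forall>\<^sub>F p in W. l2 \<le> \<sigma>z p \<and> l2 \<le> \<sigma>w p"
      using ev_W[OF bounds] by eventually_elim simp
    show "(\<lambda>p. (\<sigma> p)\<^sup>2 - \<sigma>z p * \<sigma>w p) \<in> O[W](t)"
      by (rule bigoI[where c = A0], use ev_W[OF bounds] tW in eventually_elim) simp
    show "t \<in> O[W](\<lambda>_. 1)"
      by (rule bigoI[where c = 1], use tW in eventually_elim) simp
    show "(\<lambda>p. dz p - \<sigma>z p / (2 * pi * h p)) \<in> O[W](\<lambda>_. 1)"
      by (rule bigoI[where c = A0], use ev_W[OF bounds] in eventually_elim) simp
    show "(\<lambda>p. dw p - \<sigma>w p / (2 * pi * h p)) \<in> O[W](\<lambda>_. 1)"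
      by (rule bigoI[where c = A0], use ev_W[OF bounds] in eventually_elim) simp
    show "r1 \<in> O[W](t)" "r2 \<in> O[W](t)" "r5 \<in> O[W](h)"
      using bigo_W r(1,2) \<open>r5 \<in> O[V](h)\<close> by auto
    show "\<forall>\<^sub>F p in W. d2 p =
      (\<sigma>z p * \<sigma>w p + (\<sigma> p)\<^sup>2 * (1 + r1 p) * exp (- 2 * k p)
         + (\<sigma> p)\<^sup>2 * (1 + r2 p) / (exp (k p) * sinh (k p)) * (2 * (k p)\<^sup>2 * coth (k p) - 4 * k p) + r3 p + r4 p)
       / ((2 * pi * h p)\<^sup>2 * (1 - exp (- 2 * k p))) * (1 + r5 p) + r6 p"
      using ev_W[OF d2] .
  qed
  then obtain s0 s1 s2 s3 s4 s5 where s: "s0 \<in> O[W](h)" "s1 \<in> O[W](t)" "s2 \<in> O[W](t)"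
     "s3 \<in> O[W](r3)" "s4 \<in> O[W](r4)" "s5 \<in> O[W](r6)"
     and corr: "\<forall>\<^sub>F p in W. d2 p / (dw p * dz p) =
        (1 + s0 p) / (1 - exp (- 2 * k p)) *
          (1 + (1 + s1 p) * exp (- 2 * k p)
             + (1 + s2 p) / (exp (k p) * sinh (k p)) * (2 * (k p)\<^sup>2 * coth (k p) - 4 * k p)
             + s3 p + s4 p)
        + s5 p"
    by blast
  have s3: "s3 \<in> bigo_h_infinity W"
    using r(3) landau_o.big_trans[OF s(4) bigo_W] unfolding bigo_h_infinity_def by blast
  have s4: "s4 \<in> O[W](\<lambda>p. \<Delta> p * h p powr (- 32/10))"
    using landau_o.big_trans[OF s(5) bigo_W[OF r(4)]] .
  have s5: "s5 \<in> O[W](\<lambda>p. exp (- D0 / (h p)\<^sup>2))"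
    using landau_o.big_trans[OF s(6) bigo_W[OF r(6)]] .

  \<comment> \<open>One constant for all error terms\<close>
  have "r4 \<in> O[V](h)"
    using r(4) unfolding \<Delta> by (rule bigo_h[rotated]) (rule small', simp)
  then have "s4 \<in> O[W](h)"
    using landau_o.big_trans[OF s(5) bigo_W] by blast
  moreover have "s3 \<in> O[W](h)"
    using s3 unfolding bigo_h_infinity_def h_def by (auto dest: spec[of _ 1])
  ultimately have "(\<lambda>p. s3 p + s4 p) \<in> O[W](h)"
    by (rule sum_in_bigo(1)[rotated])
  then obtain A3 where A3: "0 < A3" "\<forall>\<^sub>F p in W. norm (s3 p + s4 p) \<le> A3 * norm (h p)"
    by (elim landau_o.bigE)
  have "r6 \<in> O[V](h)"
    using exp_small r(6) by (rule bigo_h)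
  then have "s5 \<in> O[W](h)"
    using landau_o.big_trans[OF s(6) bigo_W] by blast
  then obtain A5 where A5: "0 < A5" "\<forall>\<^sub>F p in W. norm (s5 p) \<le> A5 * norm (h p)"
    by (elim landau_o.bigE)
  obtain A6 where A6: "0 < A6" "\<forall>\<^sub>F p in W. norm (s0 p) \<le> A6 * norm (h p)"
    using s(1) by (elim landau_o.bigE)
  obtain A7 where A7: "0 < A7" "\<forall>\<^sub>F p in W. norm (s1 p) \<le> A7 * norm (t p)"
    using s(2) by (elim landau_o.bigE)
  obtain A8 where A8: "0 < A8" "\<forall>\<^sub>F p in W. norm (s2 p) \<le> A8 * norm (t p)"
    using s(3) by (elim landau_o.bigE)
  obtain Az k0 where Az: "0 < Az" "0 < k0" "\<And>k. 0 < k \<Longrightarrow> k < k0 \<Longrightarrow>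
       \<bar>(1 + exp (- 2 * k) + (2 * k\<^sup>2 * coth k - 4 * k) / (exp k * sinh k)) / (1 - exp (- 2 * k)) - k\<bar> \<le> Az * k\<^sup>2 \<and>
       \<bar>exp (- 2 * k) / (1 - exp (- 2 * k))\<bar> \<le> Az / k \<and>
       \<bar>(2 * k\<^sup>2 * coth k - 4 * k) / (exp k * sinh k) / (1 - exp (- 2 * k))\<bar> \<le> Az / k \<and>
       \<bar>1 / (1 - exp (- 2 * k))\<bar> \<le> Az / k"
    using pair_function_near_zero by metis
  obtain Ai k1 where Ai: "0 < Ai" "\<And>k. k1 \<le> k \<Longrightarrow>
       \<bar>(2 * k\<^sup>2 * coth k - 4 * k) / (exp k * sinh k)\<bar> \<le> Ai * exp (- k) \<and> exp (- 2 * k) \<le> 1 / 2"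
    using pair_function_at_infinity by metis
  define A where "A = A3 + A5 + A6 + A7 + A8 + Az + Ai + B"
  have A: "0 < A" "A3 \<le> A" "A5 \<le> A" "A6 \<le> A" "A7 \<le> A" "A8 \<le> A" "Az \<le> A" "Ai \<le> A" "B \<le> A"
    using A3(1) A5(1) A6(1) A7(1) A8(1) Az(1) Ai(1) B by (simp_all add: A_def)
  have sW: "\<forall>\<^sub>F p in W. \<bar>s0 p\<bar> \<le> A * h p \<and> \<bar>s1 p\<bar> \<le> A * t p \<and> \<bar>s2 p\<bar> \<le> A * t p \<and>
      \<bar>s3 p + s4 p\<bar> \<le> A * h p \<and> \<bar>s5 p\<bar> \<le> A * h p"
    using A3(2) A5(2) A6(2) A7(2) A8(2) hW(1) tW
  proof eventually_elim
    case (elim p)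
    have mono: "\<bar>x\<bar> \<le> A * y" if "norm x \<le> X * norm y" "X \<le> A" "0 \<le> y" for x X y :: real
      using that(1) mult_right_mono[OF that(2,3)] unfolding real_norm_def abs_of_nonneg[OF that(3)] by linarith
    have "0 \<le> h p" "0 \<le> t p"
      using elim by simp_all
    then show ?case
      by (intro conjI mono[OF elim(1) A(2)] mono[OF elim(2) A(3)] mono[OF elim(3) A(4)]
          mono[OF elim(4) A(5)] mono[OF elim(5) A(6)])
  qed

  \<comment> \<open>Close range: the correlation is K to leading order\<close>
  define W1 where "W1 M = semiclassical (\<lambda>h. {(z, w) \<in> R h.
    M * h powr (4/7) \<le> cmod (z - w) \<and> M * cmod (z - w) \<le> h powr (1/2)})" for M
  define W2 where "W2 M = semiclassical (\<lambda>h. {(z, w) \<in> R h.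
    M * sqrt (h * ln (1 / h)) \<le> cmod (z - w)})" for M
  have W1W: "W1 M \<le> W" and W2W: "W2 M \<le> W" for M
    unfolding W1_def W2_def W_def by (auto intro!: semiclassical_mono)
  define \<tau> where "\<tau> p = \<sigma> p * (t p)\<^sup>2 / (4 * h p)" for p
  obtain E where E: "0 < E"
    "\<And>h t \<sigma> k F G1 G2 G3 s0 s1 s2 s3 s5. 0 < h \<Longrightarrow> h \<le> 1 \<Longrightarrow> 0 < t \<Longrightarrow> t \<le> 1 \<Longrightarrow> h ^ 3 \<le> t ^ 5 \<Longrightarrow>
      l2 \<le> \<sigma> \<Longrightarrow> \<sigma> \<le> A0 \<Longrightarrow> A * t \<le> 1 / 2 \<Longrightarrow>
      \<bar>k - \<sigma> * t\<^sup>2 / (4 * h)\<bar> \<le> \<sigma> * t\<^sup>2 / (4 * h) * (A * t) \<Longrightarrow>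
      \<bar>F - k\<bar> \<le> A * k\<^sup>2 \<Longrightarrow> \<bar>G1\<bar> \<le> A / k \<Longrightarrow> \<bar>G2\<bar> \<le> A / k \<Longrightarrow> \<bar>G3\<bar> \<le> A / k \<Longrightarrow>
      \<bar>s0\<bar> \<le> A * h \<Longrightarrow> \<bar>s1\<bar> \<le> A * t \<Longrightarrow> \<bar>s2\<bar> \<le> A * t \<Longrightarrow> \<bar>s3\<bar> \<le> A * h \<Longrightarrow> \<bar>s5\<bar> \<le> A * h \<Longrightarrow>
      \<bar>((1 + s0) * (F + s1 * G1 + s2 * G2 + s3 * G3) + s5) / (\<sigma> * t\<^sup>2 / (4 * h)) - 1\<bar> \<le> E * (t\<^sup>2 / h)"
    using short_range_bound[OF A(1) l2 A0] by metis
  \<comment> \<open>On \<open>W1 M0\<close> the quotient \<open>(t p)^2 / h p\<close> is at most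
    \<open>1 / M0\<close>, so \<open>A0 * (t p)^2 / h p\<close> stays below \<open>k0\<close>; this
    exceeds \<open>k p\<close>, and the expansion at zero applies.\<close>
  define M0 where "M0 = 1 + A0 / k0"
  have M0: "1 \<le> M0" "A0 < k0 * M0"
    using A0 Az(2) by (simp_all add: M0_def field_simps)
  have scales: "\<forall>\<^sub>F p in W1 M. 0 < t p \<and> h p ^ 3 \<le> t p ^ 5 \<and> M * ((t p)\<^sup>2 / h p) \<le> 1 \<and> t p \<le> sqrt (h p) \<and>
      0 < \<tau> p \<and> \<tau> p \<le> A0 / 4 * ((t p)\<^sup>2 / h p)" if "1 \<le> M" for M
    using filter_leD[OF W1W hW(1)] filter_leD[OF W1W ev_W[OF bounds]]
      eventually_semiclassical_mem[of "\<lambda>h. {(z, w) \<in> R h.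
           M * h powr (4/7) \<le> cmod (z - w) \<and> M * cmod (z - w) \<le> h powr (1/2)}", folded W1_def]
  proof eventually_elim
    case (elim p)
    then have "M * h p powr (4/7) \<le> t p" "M * t p \<le> h p powr (1/2)"
      by (cases p; simp add: t_def h_def)+
    note cl = close_range_scales[OF _ _ that this]
    have "0 < t p"
      using cl(1) elim by auto
    moreover have "\<tau> p = \<sigma> p / 4 * ((t p)\<^sup>2 / h p)"
      by (simp add: \<tau>_def)
    moreover have "\<sigma> p / 4 * ((t p)\<^sup>2 / h p) \<le> A0 / 4 * ((t p)\<^sup>2 / h p)"
      using elim by (intro mult_right_mono) auto
    ultimately show ?case
      using cl elim l2 by auto
  qed
  \<comment> \<open>\<open>C2\<close> controls \<open>B * t p\<close> only. For the larger constant
    \<open>A\<close>, the bound \<open>A * t p \<le> 1 / 2\<close> comes from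
    \<open>t p \<le> sqrt (h p)\<close> and small \<open>h p\<close>.\<close>
  have "\<forall>\<^sub>F p in W. h p < (1 / (2 * A))\<^sup>2"
    using order_tendstoD(2)[OF hW(2)] A(1) by simp
  from filter_leD[OF W1W this]
  have near: "\<forall>\<^sub>F p in W1 M0. \<bar>d2 p / (dw p * dz p) / \<tau> p - 1\<bar> \<le> E * ((t p)\<^sup>2 / h p)"
    using scales[OF M0(1)] filter_leD[OF W1W hW(1)] filter_leD[OF W1W tW] filter_leD[OF W1W ev_W[OF bounds]]
      filter_leD[OF W1W kW] filter_leD[OF W1W sW] filter_leD[OF W1W corr]
  proof eventually_elim
    case (elim p)
    have "t p \<le> 1 / (2 * A)"
      using elim(1,2) A(1) real_sqrt_less_mono[OF elim(1)] by simp
    then have At: "A * t p \<le> 1 / 2"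
      using A(1) by (simp add: field_simps)
    have k\<tau>: "\<bar>k p - \<tau> p\<bar> \<le> \<tau> p * (A * t p)" "\<bar>k p - \<tau> p\<bar> \<le> \<tau> p * (1 / 2)"
    proof -
      have "\<tau> p * (B * t p) \<le> \<tau> p * (A * t p)" "\<tau> p * (B * t p) \<le> \<tau> p * (1 / 2)"
        using elim A(9) by (auto intro!: mult_left_mono mult_right_mono)
      then show "\<bar>k p - \<tau> p\<bar> \<le> \<tau> p * (A * t p)" "\<bar>k p - \<tau> p\<bar> \<le> \<tau> p * (1 / 2)"
        using elim(6) unfolding \<tau>_def by linarith+
    qed
    have "A0 * ((t p)\<^sup>2 / h p) < k0 * M0 * ((t p)\<^sup>2 / h p)"
      using M0 elim by (intro mult_strict_right_mono) auto
    also have "\<dots> \<le> k0"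
      using elim(2) mult_left_mono[of "M0 * ((t p)\<^sup>2 / h p)" 1 k0] Az(2) by simp
    finally have "0 < k p" "k p < k0"
      using k\<tau>(2) elim(2) by linarith+
    note z = Az(3)[OF this]
    have Ak: "Az / k p \<le> A / k p" "Az * (k p)\<^sup>2 \<le> A * (k p)\<^sup>2"
      using A \<open>0 < k p\<close> by (simp_all add: divide_right_mono mult_right_mono)
    define e q N where "e = exp (- 2 * k p)" and "q = exp (k p) * sinh (k p)"
      and "N = 2 * (k p)\<^sup>2 * coth (k p) - 4 * k p"
    \<comment> \<open>Distributing the denominator isolates the cancelling combination
      \<open>(1 + e + N / q) / y\<close> and leaves each error with a coefficient of size
      \<open>1 / k p\<close>.\<close>
    have split: "(1 + x0) / y * (1 + (1 + x1) * e + (1 + x2) / q * N + x3 + x4) + x5 =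
        (1 + x0) * ((1 + e + N / q) / y + x1 * (e / y) + x2 * (N / q / y) + (x3 + x4) * (1 / y)) + x5"
      for x0 x1 x2 x3 x4 x5 y :: real
      by (simp add: divide_inverse algebra_simps)
    have F: "\<bar>(1 + e + N / q) / (1 - e) - k p\<bar> \<le> A * (k p)\<^sup>2" "\<bar>e / (1 - e)\<bar> \<le> A / k p"
      "\<bar>N / q / (1 - e)\<bar> \<le> A / k p" "\<bar>1 / (1 - e)\<bar> \<le> A / k p"
      using z Ak unfolding e_def q_def N_def by linarith+
    have b: "0 < h p" "h p \<le> 1" "0 < t p" "t p \<le> 1" "h p ^ 3 \<le> t p ^ 5" "l2 \<le> \<sigma> p" "\<sigma> p \<le> A0"
      using elim(2-5) by simp_all
    have s': "\<bar>s0 p\<bar> \<le> A * h p" "\<bar>s1 p\<bar> \<le> A * t p" "\<bar>s2 p\<bar> \<le> A * t p"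
      "\<bar>s3 p + s4 p\<bar> \<le> A * h p" "\<bar>s5 p\<bar> \<le> A * h p"
      using elim(7) by simp_all
    show ?case
      unfolding elim(8) \<tau>_def e_def[symmetric] q_def[symmetric] N_def[symmetric] split
      by (rule E(2)[OF b At k\<tau>(1)[unfolded \<tau>_def] F s'])
  qed

  have close: "\<exists>r. r \<in> O[W1 M0](\<lambda>p. (t p)\<^sup>2 / h p + \<Delta> p * h p powr (- 8/5)) \<and>
      (\<forall>\<^sub>F p in W1 M0. d2 p / (dw p * dz p) = \<tau> p * (1 + r p))"
  proof (intro exI conjI)
    \<comment> \<open>As \<tau> is positive, the remainder can be defined by solving for it. Its
      bound by \<open>(t p)^2 / h p\<close> only grows when the nonnegative coupling term is
      added.\<close>
    show "(\<lambda>p. d2 p / (dw p * dz p) / \<tau> p - 1) \<in> O[W1 M0](\<lambda>p. (t p)\<^sup>2 / h p + \<Delta> p * h p powr (- 8/5))"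
    proof (rule bigoI[where c = E])
      show "\<forall>\<^sub>F p in W1 M0. norm (d2 p / (dw p * dz p) / \<tau> p - 1) \<le> E * norm ((t p)\<^sup>2 / h p + \<Delta> p * h p powr (- 8/5))"
        using near filter_leD[OF W1W hW(1)]
          filter_leD[OF W1W eventually_semiclassical_fst[OF small, of R, folded W_def h_def, unfolded \<Delta>[symmetric]]]
      proof eventually_elim
        case (elim p)
        have "0 \<le> \<Delta> p * h p powr (- 8/5)" "0 \<le> (t p)\<^sup>2 / h p"
          using elim by (auto simp: \<Delta>)
        then show ?case
          using elim(1) mult_left_mono[of "(t p)\<^sup>2 / h p" "(t p)\<^sup>2 / h p + \<Delta> p * h p powr (- 8/5)" E] E(1) by simp
      qed
    qed
    show "\<forall>\<^sub>F p in W1 M0. d2 p / (dw p * dz p) = \<tau> p * (1 + (d2 p / (dw p * dz p) / \<tau> p - 1))"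
      using scales[OF M0(1)] by eventually_elim simp
  qed

  have vanish: "\<exists>M>0. \<forall>\<^sub>F p in W1 M. \<bar>d2 p / (dw p * dz p)\<bar> \<le> \<eta>" if \<eta>: "0 < \<eta>" for \<eta>
  proof -
    \<comment> \<open>The correlation is at most \<open>(1 + E) * \<tau> p\<close>, hence at most
      \<open>Y * ((t p)^2 / h p)\<close>. On \<open>W1 M\<close> this quotient is at most
      \<open>1 / M\<close>, and \<open>M\<close> is chosen with
      \<open>Y \<le> \<eta> * M\<close>.\<close>
    define Y where "Y = A0 / 4 * (1 + E)"
    define M where "M = M0 + Y / \<eta>"
    have "0 \<le> Y"
      using A0 E(1) by (simp add: Y_def)
    then have "0 \<le> Y / \<eta>" "\<eta> * M = \<eta> * M0 + Y" "0 \<le> \<eta> * M0"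
      using \<eta> M0 by (simp_all add: M_def distrib_left)
    then have M: "M0 \<le> M" "1 \<le> M" "Y \<le> \<eta> * M"
      using M0 by (simp_all add: M_def)
    have "W1 M \<le> W1 M0"
      unfolding W1_def
    proof (intro semiclassical_mono, clarify)
      fix h z w
      assume "M * h powr (4/7) \<le> cmod (z - w)" "M * cmod (z - w) \<le> h powr (1/2)"
      moreover have "M0 * h powr (4/7) \<le> M * h powr (4/7)" "M0 * cmod (z - w) \<le> M * cmod (z - w)"
        using M by (auto intro: mult_right_mono)
      ultimately show "M0 * h powr (4/7) \<le> cmod (z - w) \<and> M0 * cmod (z - w) \<le> h powr (1/2)"
        by linarith
    qed
    from filter_leD[OF this near] scales[OF M(2)] filter_leD[OF W1W hW(1)]
    have "\<forall>\<^sub>F p in W1 M. \<bar>d2 p / (dw p * dz p)\<bar> \<le> \<eta>"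
    proof eventually_elim
      case (elim p)
      define x where "x = (t p)\<^sup>2 / h p"
      have x: "0 \<le> x" "M * x \<le> 1"
        using elim by (auto simp: x_def)
      then have "x \<le> 1"
        using mult_right_mono[OF M(2) x(1)] by linarith
      then have "E * x \<le> E"
        using E(1) by simp
      define y where "y = d2 p / (dw p * dz p)"
      have "\<bar>y / \<tau> p\<bar> \<le> 1 + E"
        using elim(1) \<open>E * x \<le> E\<close> unfolding x_def y_def by linarith
      then have "\<tau> p * \<bar>y / \<tau> p\<bar> \<le> \<tau> p * (1 + E)"
        using elim(2) by (intro mult_left_mono) auto
      then have "\<bar>y\<bar> \<le> \<tau> p * (1 + E)"
        using elim(2) by (simp add: abs_divide)
      also have "\<dots> \<le> A0 / 4 * x * (1 + E)"
        using elim(2) E(1) unfolding x_def by (intro mult_right_mono) auto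
      also have "\<dots> = Y * x"
        by (simp add: Y_def)
      also have "\<dots> \<le> \<eta> * M * x"
        by (rule mult_right_mono[OF M(3) x(1)])
      also have "\<dots> \<le> \<eta>"
        using mult_left_mono[OF x(2), of \<eta>] \<eta> by (simp add: mult.assoc)
      finally show ?case
        unfolding y_def .
    qed
    then show ?thesis
      using M(2) by (intro exI[of _ M]) auto
  qed

  \<comment> \<open>Long range: the exponential terms are O(h)\<close>
  define M2 where "M2 = 1 + 8 / l2"
  \<comment> \<open>The 8 is 4 times 2: \<tau> carries the denominator 4, and
    \<open>2 * ln (1 / h p) \<le> \<tau> p\<close> is wanted because \<open>k p\<close> is only
    known to be at least half of \<open>\<tau> p\<close>. Then
    \<open>exp (- k p) \<le> h p\<close>.\<close>
  have M2: "0 < M2" "8 \<le> l2 * M2\<^sup>2"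
  proof -
    show "0 < M2"
      using l2 by (simp add: M2_def add_pos_pos)
    have "8 \<le> l2 * M2" "1 \<le> M2"
      using l2 by (simp_all add: M2_def distrib_left)
    moreover from this have "l2 * M2 * 1 \<le> l2 * M2 * M2"
      using l2 by (intro mult_left_mono) auto
    ultimately show "8 \<le> l2 * M2\<^sup>2"
      by (simp add: power2_eq_square)
  qed
  \<comment> \<open>Since \<open>k p\<close> will dominate \<open>ln (1 / h p)\<close>, it also
    passes the threshold \<open>k1\<close> of the estimate at infinity.\<close>
  have "\<forall>\<^sub>F x in at_right 0. k1 \<le> ln (1 / x) \<and> x < (1::real)"
    by (intro eventually_conj; real_asymp)
  from filter_leD[OF W2W eventually_semiclassical_fst[OF this, of R, folded W_def h_def]]
  have "\<forall>\<^sub>F p in W2 M2. \<bar>d2 p / (dw p * dz p) - 1\<bar> \<le> (2 * (1 + A) * ((1 + A) + (1 + A) * A + A + 1) + 2 * A) * h p"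
    using filter_leD[OF W2W hW(1)] filter_leD[OF W2W tW] filter_leD[OF W2W ev_W[OF bounds]]
      filter_leD[OF W2W kW] filter_leD[OF W2W sW] filter_leD[OF W2W corr]
      eventually_semiclassical_mem[of "\<lambda>h. {(z, w) \<in> R h. M2 * sqrt (h * ln (1 / h)) \<le> cmod (z - w)}", folded W2_def]
  proof eventually_elim
    case (elim p)
    have ln0: "0 \<le> ln (1 / h p)"
      using elim(1,2) by simp
    have "M2 * sqrt (h p * ln (1 / h p)) \<le> t p"
      using elim(8) by (cases p) (simp add: t_def h_def)
    then have "(M2 * sqrt (h p * ln (1 / h p)))\<^sup>2 \<le> (t p)\<^sup>2"
      using M2 elim(2) ln0 by (intro power_mono) auto
    then have "M2\<^sup>2 * ln (1 / h p) \<le> (t p)\<^sup>2 / h p"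
      using elim(2) ln0 by (simp add: power_mult_distrib field_simps)
    then have "l2 * (M2\<^sup>2 * ln (1 / h p)) \<le> \<sigma> p * ((t p)\<^sup>2 / h p)"
      using elim(4) l2 ln0 by (intro mult_mono) auto
    moreover have "8 * ln (1 / h p) \<le> l2 * M2\<^sup>2 * ln (1 / h p)"
      using M2 ln0 by (intro mult_right_mono) auto
    moreover have "\<tau> p = \<sigma> p * ((t p)\<^sup>2 / h p) / 4"
      by (simp add: \<tau>_def)
    ultimately have \<tau>: "2 * ln (1 / h p) \<le> \<tau> p"
      by (simp add: mult.assoc)
    then have "\<tau> p * (B * t p) \<le> \<tau> p * (1 / 2)"
      using elim(3) ln0 by (intro mult_left_mono) auto
    then have k: "ln (1 / h p) \<le> k p"
      using elim(5) \<tau> unfolding \<tau>_def[symmetric] by linarith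
    then have "exp (- k p) \<le> exp (- ln (1 / h p))"
      by simp
    also have "\<dots> = h p"
      using elim(2) by (simp add: ln_div)
    finally have ek: "exp (- k p) \<le> h p" .
    have k1: "k1 \<le> k p"
      using k elim(1) by linarith
    have "Ai * exp (- k p) \<le> A * h p"
      using ek A Ai(1) by (intro mult_mono) auto
    then have G: "\<bar>(2 * (k p)\<^sup>2 * coth (k p) - 4 * k p) / (exp (k p) * sinh (k p))\<bar> \<le> A * h p"
      using Ai(2)[OF k1] by linarith
    have "exp (- 2 * k p) \<le> exp (- k p)"
      using k ln0 by simp
    then have e: "exp (- 2 * k p) \<le> h p"
      using ek by linarith
    have st: "\<bar>s1 p\<bar> \<le> A" "\<bar>s2 p\<bar> \<le> A"
    proof -
      have "A * t p \<le> A"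
        using elim(3) A(1) by simp
      then show "\<bar>s1 p\<bar> \<le> A" "\<bar>s2 p\<bar> \<le> A"
        using elim(6) by linarith+
    qed
    have "d2 p / (dw p * dz p) = (1 + s0 p) / (1 - exp (- 2 * k p)) *
          (1 + (1 + s1 p) * exp (- 2 * k p)
             + (1 + s2 p) * ((2 * (k p)\<^sup>2 * coth (k p) - 4 * k p) / (exp (k p) * sinh (k p)))
             + (s3 p + s4 p)) + s5 p"
      unfolding elim(7) by (simp add: add.assoc)
    then show ?case
      using long_range_bound[OF A(1) elim(2) _ _ _ e G _ st, of "s0 p" "s3 p + s4 p" "s5 p"]
        elim(4,6) Ai(2)[OF k1] by simp
  qed
  with filter_leD[OF W2W hW(1)]
  have "\<forall>\<^sub>F p in W2 M2. norm (d2 p / (dw p * dz p) - 1) \<le>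
      (2 * (1 + A) * ((1 + A) + (1 + A) * A + A + 1) + 2 * A) * norm (h p)"
    by eventually_elim simp
  then have far: "(\<lambda>p. d2 p / (dw p * dz p) - 1) \<in> O[W2 M2](h)"
    by (rule bigoI)

  \<comment> \<open>Assembly of the three statements\<close>
  have main: "\<exists>D'>0. \<exists>r0 r1 r2 r3 r4 r5.
     r0 \<in> O[W](h) \<and> r1 \<in> O[W](t) \<and> r2 \<in> O[W](t) \<and> r3 \<in> bigo_h_infinity W \<and>
     r4 \<in> O[W](\<lambda>p. \<Delta> p * h p powr (- 32/10)) \<and> r5 \<in> O[W](\<lambda>p. exp (- D' / (h p)\<^sup>2)) \<and>
     (\<forall>\<^sub>F p in W. d2 p / (dw p * dz p) =
        (1 + r0 p) / (1 - exp (- 2 * k p)) *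
          (1 + (1 + r1 p) * exp (- 2 * k p)
             + (1 + r2 p) / (exp (k p) * sinh (k p)) * (2 * (k p)\<^sup>2 * coth (k p) - 4 * k p)
             + r3 p + r4 p)
        + r5 p)"
    using D0 s(1-3) s3 s4 s5 corr by blast
  show ?thesis
    unfolding Let_def two_point_correlation_def
  proof (rule exI[of _ C2], rule conjI[OF C2(1)], fold R_def, fold W_def W1_def W2_def, intro conjI)
    show "\<exists>D'>0. \<exists>r0 r1 r2 r3 r4 r5.
       r0 \<in> O[W](\<lambda>(h, z, w). h) \<and>
       r1 \<in> O[W](\<lambda>(h, z, w). cmod (z - w)) \<and>
       r2 \<in> O[W](\<lambda>(h, z, w). cmod (z - w)) \<and>
       r3 \<in> bigo_h_infinity W \<and>
       r4 \<in> O[W](\<lambda>(h, z, w). \<delta> h * h powr (- 32/10)) \<and>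
       r5 \<in> O[W](\<lambda>(h, z, w). exp (- D' / h\<^sup>2)) \<and>
       (\<forall>\<^sub>F (h, z, w) in W. D h z w / (d h w * d h z) =
               (1 + r0 (h, z, w)) / (1 - exp (- 2 * K h z w)) *
                 (1 + (1 + r1 (h, z, w)) * exp (- 2 * K h z w)
                    + (1 + r2 (h, z, w)) / (exp (K h z w) * sinh (K h z w)) * (2 * (K h z w)\<^sup>2 * coth (K h z w) - 4 * K h z w)
                    + r3 (h, z, w) + r4 (h, z, w))
               + r5 (h, z, w))"
      using main unfolding defs by (simp add: case_prod_unfold)
    show "\<exists>M>0. \<exists>r. r \<in> O[W1 M](\<lambda>(h, z, w). (cmod (z - w))\<^sup>2 / h + \<delta> h * h powr (- 8/5)) \<and>
           (\<forall>\<^sub>F (h, z, w) in W1 M.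
              D h z w / (d h w * d h z) = \<sigma>h h z w * (cmod (z - w))\<^sup>2 / (4 * h) * (1 + r (h, z, w)))"
      using close M0(1) unfolding defs \<tau>_def by (intro exI[of _ M0]) (simp add: case_prod_unfold)
    show "\<forall>\<eta>>0. \<exists>M>0. \<forall>\<^sub>F (h, z, w) in W1 M. \<bar>D h z w / (d h w * d h z)\<bar> \<le> \<eta>"
      using vanish unfolding defs by (simp add: case_prod_unfold)
    show "\<exists>M>0. (\<lambda>(h, z, w). D h z w / (d h w * d h z) - 1) \<in> O[W2 M](\<lambda>(h, z, w). h)"
      using far M2(1) unfolding defs by (intro exI[of _ M2]) (simp add: case_prod_unfold)
  qed
qed

end
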